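(* Let $\nu>0$, let $\{c_n\}_{n\ge1}$ be real numbers and $\{k_n\}_{n\ge1}$ positive integers with $c_n,k_n\to+\infty$ and $c_n/k_n\to0$, let $r_n=[n/k_n]$, and let $v_n=u^{(\nu)}_{[n/c_n]}$ be levels satisfying $$nP(X_1\le v_n<X_2)-c_n\nu\to0 \qquad (n\to+\infty).$$ Suppose there exists a sequence of integers $\{l_n\}_{n\ge1}$ such that, for the levels $v_n$, $$k_n\left[\alpha_{n,l_n-2}+P\left(\widetilde N_n([0,l_n/n])>0\right)\right]\to0,$$ that $$E\left[Z_j(v_n)\,\mathbf 1_{\{\widehat N_{r_n}>1\}}\right]=o(1)\quad\text{uniformly in } j=1,\ldots,r_n,$$ and that $$E\left[Z_1^*(v_n)\mathbf 1_{\{Z_1^*(v_n)>c_n\}}\right]\to0,\qquad c_n^{-1}E\left[(Z_1^*(v_n))^2\mathbf 1_{\{Z_1^*(v_n)\le c_n\}}\right]\to0.$$ Then $\widehat\eta_n^*\to\eta$ in probability as $n\to+\infty$, where $\widehat\eta_n^*=\widehat N_n/\overline N_n$ (at the levels $v_n$).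
   Context: $\mathbf X=\{X_n\}_{n\ge1}$ is a stationary sequence of real random variables; $[x]$ is the integer part and $\mathbf 1_A$ the indicator of $A$. For a level $u$, there is an upcrossing of $u$ at $i$ if $X_i\le u<X_{i+1}$. For levels $\mathbf u=\{u_n\}$, $\widetilde N_n(B)=\sum_{i=1}^{n-1}\mathbf 1_{\{X_i\le u_n<X_{i+1}\}}\delta_{i/n}(B)$, $B\subset[0,1]$, where $\delta_a$ is unit mass at $a$; $\widetilde N_{i,j}$ is the number of upcrossings of $u_n$ at indices $i,\dots,j$ (and $0$ if $j<i$); in particular $\widetilde N_{i,i}=\mathbf 1_{\{X_i\le u_n<X_{i+1}\}}$. Mixing coefficients and condition $\Delta(\mathbf u)$: $\alpha_{n,l}=\max\{|P(A\cap B)-P(A)P(B)|: A\in\mathcal B_1^k(u_n),\,B\in\mathcal B_{k+l}^n(u_n),\,1\le k\le n-l\}$, where $\mathcal B_a^b(u_n)$ is the $\sigma$-field generated by the events $\{X_i\le u_n\}$, $a\le i\le b$. Condition $\Delta(\mathbf u)$ holds if $\alpha_{n,l_n}\to0$ for some $l_n=o(n)$. Condition $\widetilde D^{(3)}(\mathbf u)$: $\Delta(\mathbf u)$ holds and $nP(X_1\le u_n<X_2,\ \widetilde N_{3,3}=0,\ \widetilde N_{4,r'_n}>0)\to0$ for some $r'_n=[n/k'_n]$, where $k'_n$ are positive integers with $k'_n\to\infty$, $k'_nl_n/n\to0$, $k'_n\alpha_{n,l_n}\to0$. Upcrossings index: for each $\nu>0$ there are levels $\mathbf u^{(\nu)}=\{u_n^{(\nu)}\}$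 with $nP(X_1\le u_n^{(\nu)}<X_2)\to\nu$, and $P(\widetilde N_n([0,1])=0)\to e^{-\eta\nu}$ for these levels, with a constant $0\le\eta\le1$; then $\mathbf X$ has upcrossings index $\eta$. For levels $u_n$, let $Y_i=0$ if $\widetilde N_{i+2,i+2}=0$, and $Y_i=k\ge1$ if $X_{i+2}\le u_n<X_{i+3},\,X_{i+4}\le u_n<X_{i+5},\ldots,X_{i+2k}\le u_n<X_{i+2k+1}$ and $\widetilde N_{i+2k+2,i+2k+2}=0$. $Z_i(u_n)$ is the length $Y_i$ given the event $A_i=\{\widetilde N_{i,i}=0,\ X_{i+2}\le u_n<X_{i+3}\}$; that is, $P(Z_i(u_n)=k)=P(Y_i=k\mid A_i)$, $k\ge1$ (independent of $i$), and an expectation $E[Z_j(u_n)\mathbf 1_C]$ with $C$ an event determined by $\mathbf X$ means $E[Y_j\mathbf 1_C\mid A_j]$. At the levels $v_n$ (that is, with $\widetilde N_n$, $\widetilde N_{i,j}$, $\alpha_{n,l}$, $Y_i$, $A_i$ and $Z_i(u_n)$ all taken with $u_n=v_n$): $\widehat N_n=\sum_{i=1}^{n-3}\mathbf 1_{A_i}$, $\overline N_n=\sum_{i=1}^{n-3}Y_i\mathbf 1_{A_i}$, and $\widehat N_{r_n}$, $\overline N_{r_n}$ are the same sums restricted to $i\le r_n$. $Z_1^*(v_n)$ is a random variable with the distribution of $Z_1(v_n)$. Standing assumptions: for each $\nu>0$, $\mathbf X$ satisfies $\widetilde D^{(3)}(\mathbf u^{(\nu)})$ and $P(X_3\le u_n^{(\nu)}<X_4,\ldots,X_{2j-1}\le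 u_n^{(\nu)}<X_{2j})\to0$ as $j\to\infty$; $\mathbf X$ has upcrossings index $\eta>0$; and $E[Z_1(v_n)]\to1/\eta$. *)

theory Defs
  imports "HOL-Probability.Probability" "HOL-Library.Landau_Symbols"
begin

text \<open>
  A sequence \<open>X\<^sub>1, X\<^sub>2, \<dots>\<close> of random variables on \<open>M\<close> is a function \<open>X :: nat \<Rightarrow> 'a \<Rightarrow> real\<close> of
  which only the values at indices \<open>\<ge> 1\<close> are used. A level is a real number \<open>u\<close>; a sequence of
  levels is a function \<open>us :: nat \<Rightarrow> real\<close>.
\<close>

definition stationary_seq :: "'a measure \<Rightarrow> (nat \<Rightarrow> 'a \<Rightarrow> real) \<Rightarrow> bool" where
  "stationary_seq M X \<longleftrightarrow>
     (\<forall>i\<ge>1. X i \<in> borel_measurable M) \<and>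
     (\<forall>h. distr M (PiM {1..} (\<lambda>_. borel)) (\<lambda>\<omega>. \<lambda>i\<in>{1..}. X (i + h) \<omega>)
        = distr M (PiM {1..} (\<lambda>_. borel)) (\<lambda>\<omega>. \<lambda>i\<in>{1..}. X i \<omega>))"

definition upcross :: "(nat \<Rightarrow> 'a \<Rightarrow> real) \<Rightarrow> real \<Rightarrow> nat \<Rightarrow> 'a \<Rightarrow> bool" where
  "upcross X u i \<omega> \<longleftrightarrow> X i \<omega> \<le> u \<and> u < X (i + 1) \<omega>"

definition upcross_process ::
  "(nat \<Rightarrow> 'a \<Rightarrow> real) \<Rightarrow> real \<Rightarrow> nat \<Rightarrow> real set \<Rightarrow> 'a \<Rightarrow> nat" where
  "upcross_process X u n B \<omega> =
     (\<Sum>i=1..n - 1. of_bool (upcross X u i \<omega>) * indicator B (real i / real n))"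

definition upcross_count :: "(nat \<Rightarrow> 'a \<Rightarrow> real) \<Rightarrow> real \<Rightarrow> nat \<Rightarrow> nat \<Rightarrow> 'a \<Rightarrow> nat" where
  "upcross_count X u i j \<omega> = (\<Sum>m=i..j. of_bool (upcross X u m \<omega>))"

text \<open>
  The bounds and the lag are integers because a lag of the form \<open>l - 2\<close> occurs below; indices of
  \<open>X\<close> always stay \<open>\<ge> 1\<close>. The \<open>0\<close> inserted in the supremum only matters when no \<open>k\<close> is
  admissible (otherwise \<open>A = {}\<close> already contributes \<open>0\<close>). The \<open>\<sigma>\<close>-fields being finite, the
  supremum is a maximum.
\<close>

definition level_field ::
  "'a measure \<Rightarrow> (nat \<Rightarrow> 'a \<Rightarrow> real) \<Rightarrow> real \<Rightarrow> int \<Rightarrow> int \<Rightarrow> 'a set set" where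
  "level_field M X u a b =
     sigma_sets (space M) {{\<omega> \<in> space M. X i \<omega> \<le> u} | i. 1 \<le> i \<and> a \<le> int i \<and> int i \<le> b}"

definition mixing_coeff ::
  "'a measure \<Rightarrow> (nat \<Rightarrow> 'a \<Rightarrow> real) \<Rightarrow> real \<Rightarrow> nat \<Rightarrow> int \<Rightarrow> real" where
  "mixing_coeff M X u n l = Sup (insert 0
     {\<bar>measure M (A \<inter> B) - measure M A * measure M B\<bar> | A B k.
        1 \<le> k \<and> k \<le> int n - l \<and>
        A \<in> level_field M X u 1 k \<and> B \<in> level_field M X u (k + l) (int n)})"

definition Delta_with ::
  "'a measure \<Rightarrow> (nat \<Rightarrow> 'a \<Rightarrow> real) \<Rightarrow> (nat \<Rightarrow> real) \<Rightarrow> (nat \<Rightarrow> int) \<Rightarrow> bool" where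
  "Delta_with M X us l \<longleftrightarrow>
     (\<lambda>n. real_of_int (l n)) \<in> o(\<lambda>n. real n) \<and>
     (\<lambda>n. mixing_coeff M X (us n) n (l n)) \<longlonglongrightarrow> 0"

text \<open>The sequence \<open>l\<close> in the rate conditions on \<open>k\<close> is the one for which \<open>\<Delta>\<close> holds.\<close>

definition D3_condition ::
  "'a measure \<Rightarrow> (nat \<Rightarrow> 'a \<Rightarrow> real) \<Rightarrow> (nat \<Rightarrow> real) \<Rightarrow> bool" where
  "D3_condition M X us \<longleftrightarrow>
     (\<exists>l. Delta_with M X us l \<and>
       (\<exists>k :: nat \<Rightarrow> nat.
          (\<forall>n\<ge>1. k n > 0) \<and> filterlim k at_top sequentially \<and>
          (\<lambda>n. real (k n) * real_of_int (l n) / real n) \<longlonglongrightarrow> 0 \<and>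
          (\<lambda>n. real (k n) * mixing_coeff M X (us n) n (l n)) \<longlonglongrightarrow> 0 \<and>
          (\<lambda>n. real n * measure M {\<omega> \<in> space M. upcross X (us n) 1 \<omega> \<and>
                  upcross_count X (us n) 3 3 \<omega> = 0 \<and>
                  upcross_count X (us n) 4 (n div k n) \<omega> > 0}) \<longlonglongrightarrow> 0))"

text \<open>\<open>u \<nu> n\<close> is the level \<open>u\<^sub>n\<close> of the sequence belonging to \<open>\<nu>\<close>.\<close>

definition has_upcrossings_index ::
  "'a measure \<Rightarrow> (nat \<Rightarrow> 'a \<Rightarrow> real) \<Rightarrow> (real \<Rightarrow> nat \<Rightarrow> real) \<Rightarrow> real \<Rightarrow> bool" where
  "has_upcrossings_index M X u \<eta> \<longleftrightarrow> 0 \<le> \<eta> \<and> \<eta> \<le> 1 \<and>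
     (\<forall>\<nu>>0.
        (\<lambda>n. real n * measure M {\<omega> \<in> space M. upcross X (u \<nu> n) 1 \<omega>}) \<longlonglongrightarrow> \<nu> \<and>
        (\<lambda>n. measure M {\<omega> \<in> space M. upcross_process X (u \<nu> n) n {0..1} \<omega> = 0})
           \<longlonglongrightarrow> exp (- \<eta> * \<nu>))"

text \<open>
  \<open>run_length\<close> is \<open>Y\<^sub>i\<close>: upcrossings at \<open>i + 2, i + 4, \<dots>, i + 2k\<close> and none at \<open>i + 2k + 2\<close>. There is
  at most one such \<open>k\<close>, and \<open>k = 0\<close> means no upcrossing at \<open>i + 2\<close>. The value for a run that never
  ends, which has probability \<open>0\<close> under the assumptions made on the levels, is set to \<open>0\<close>.
\<close>

definition run_length_is ::
  "(nat \<Rightarrow> 'a \<Rightarrow> real) \<Rightarrow> real \<Rightarrow> nat \<Rightarrow> 'a \<Rightarrow> nat \<Rightarrow> bool" where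
  "run_length_is X u i \<omega> k \<longleftrightarrow>
     (\<forall>j\<in>{1..k}. upcross X u (i + 2 * j) \<omega>) \<and>
     upcross_count X u (i + 2 * k + 2) (i + 2 * k + 2) \<omega> = 0"

definition run_length :: "(nat \<Rightarrow> 'a \<Rightarrow> real) \<Rightarrow> real \<Rightarrow> nat \<Rightarrow> 'a \<Rightarrow> nat" where
  "run_length X u i \<omega> =
     (if \<exists>k. run_length_is X u i \<omega> k then THE k. run_length_is X u i \<omega> k else 0)"

definition run_start ::
  "'a measure \<Rightarrow> (nat \<Rightarrow> 'a \<Rightarrow> real) \<Rightarrow> real \<Rightarrow> nat \<Rightarrow> 'a set" where
  "run_start M X u i =
     {\<omega> \<in> space M. upcross_count X u i i \<omega> = 0 \<and> upcross X u (i + 2) \<omega>}"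

text \<open>
  \<open>Z_dist M X u i\<close> is the law of \<open>Z\<^sub>i(u)\<close>, i.e. of \<open>Y\<^sub>i\<close> given \<open>A\<^sub>i\<close>. Expectations of \<open>Z\<close> are
  nonnegative integrals in \<open>ennreal\<close>, so that an infinite expectation is \<open>\<infinity>\<close>.
\<close>

definition Z_dist :: "'a measure \<Rightarrow> (nat \<Rightarrow> 'a \<Rightarrow> real) \<Rightarrow> real \<Rightarrow> nat \<Rightarrow> nat measure" where
  "Z_dist M X u i =
     distr (uniform_measure M (run_start M X u i)) (count_space UNIV) (run_length X u i)"

definition Z_expect_on ::
  "'a measure \<Rightarrow> (nat \<Rightarrow> 'a \<Rightarrow> real) \<Rightarrow> real \<Rightarrow> nat \<Rightarrow> 'a set \<Rightarrow> ennreal" where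
  "Z_expect_on M X u j C =
     (\<integral>\<^sup>+\<omega>. of_nat (run_length X u j \<omega>) * indicator C \<omega>
        \<partial>uniform_measure M (run_start M X u j))"

text \<open>The sums over \<open>i = 1, \<dots>, m\<close>; \<open>m = n - 3\<close> gives those of the estimator.\<close>

definition N_hat ::
  "'a measure \<Rightarrow> (nat \<Rightarrow> 'a \<Rightarrow> real) \<Rightarrow> real \<Rightarrow> nat \<Rightarrow> 'a \<Rightarrow> nat" where
  "N_hat M X u m \<omega> = (\<Sum>i=1..m. indicator (run_start M X u i) \<omega>)"

definition N_bar ::
  "'a measure \<Rightarrow> (nat \<Rightarrow> 'a \<Rightarrow> real) \<Rightarrow> real \<Rightarrow> nat \<Rightarrow> 'a \<Rightarrow> nat" where
  "N_bar M X u m \<omega> =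
     (\<Sum>i=1..m. run_length X u i \<omega> * indicator (run_start M X u i) \<omega>)"

definition eta_hat ::
  "'a measure \<Rightarrow> (nat \<Rightarrow> 'a \<Rightarrow> real) \<Rightarrow> real \<Rightarrow> nat \<Rightarrow> 'a \<Rightarrow> real" where
  "eta_hat M X u n \<omega> = real (N_hat M X u (n - 3) \<omega>) / real (N_bar M X u (n - 3) \<omega>)"

definition tendsto_in_prob :: "'a measure \<Rightarrow> (nat \<Rightarrow> 'a \<Rightarrow> real) \<Rightarrow> real \<Rightarrow> bool" where
  "tendsto_in_prob M W a \<longleftrightarrow>
     (\<forall>\<epsilon>>0. (\<lambda>n. measure M {\<omega> \<in> space M. \<bar>W n \<omega> - a\<bar> > \<epsilon>}) \<longlonglongrightarrow> 0)"

end

theory Submission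
  imports Defs
begin

text \<open>
  Both \<open>N_hat\<close> and \<open>N_bar\<close> are sums of \<open>f (run_length)\<close> over the starts of runs of upcrossings,
  with \<open>f = 1\<close> and with \<open>f\<close> the identity. The proof is a weak law of large numbers for such sums,
  lemma \<open>mark_sum_weak_law\<close>: divided by \<open>c n\<close> they converge in probability to \<open>\<nu> * \<eta>\<close> and to \<open>\<nu>\<close>,
  so that their quotient converges to \<open>\<eta>\<close>.

  The two constants are limits of expectations. By stationarity and since almost every run is finite,
  every upcrossing is counted in exactly one run, so that the expectation of the length of the run
  that starts at a given index, counted as \<open>0\<close> if none starts there, is the probability \<open>p\<close> of an
  upcrossing at a given index (\<open>run_mean\<close>), and \<open>n * p / c n\<close> tends to \<open>\<nu>\<close> by the choice of the
  levels. The mean length of a run is \<open>p / a\<close> where \<open>a\<close> is the probability of a run start; it tends to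
  \<open>1 / \<eta>\<close>, hence \<open>n * a / c n\<close> tends to \<open>\<nu> * \<eta>\<close>.

  For the concentration the indices are cut into \<open>k n\<close> blocks of length \<open>r n\<close>. Since only
  \<open>k n * \<alpha>\<close> is small and not \<open>(k n)\<^sup>2 * \<alpha>\<close>, a variance bound is not available, but the
  Laplace transform of the sum over the blocks factorises up to \<open>k n * \<alpha>\<close>
  (\<open>laplace_factorisation\<close>), once the run lengths are truncated at \<open>c n\<close> and the end of each block
  is cut off, so that different blocks are determined by well separated variables. A block contains
  more than one run only with a probability that is negligible in the sense of the assumptions, and
  in the case of one run the inequalities \<open>x - x\<^sup>2 / 2 \<le> 1 - exp (- x) \<le> x\<close> show that the
  Laplace transform of a block differs from \<open>1\<close> by the mean up to a second moment term
  (\<open>block_laplace_bounds\<close>). So the transform of the sum converges to that of a constant, and its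
  values at \<open>1\<close> and \<open>2\<close> already force convergence in probability (\<open>tendsto_in_prob_of_laplace\<close>).

  It remains to see that the parts that are cut off are negligible, i.e. that \<open>c n\<close> and the mixing
  distance \<open>l n\<close> are small compared with \<open>r n\<close>. The first holds because the probability of an upcrossing
  at a single index is \<open>o(1 / k n)\<close>. The second holds because an upcrossing among the
  first \<open>l n\<close> indices has probability \<open>o(1 / k n)\<close>, whereas a block contains an upcrossing with
  probability of order \<open>c n / k n\<close> (\<open>up_block_lower_bound\<close>); this is \<open>block_structure\<close>.
\<close>

section \<open>Runs of upcrossings\<close>

definition starts_run :: "(nat \<Rightarrow> 'a \<Rightarrow> real) \<Rightarrow> real \<Rightarrow> nat \<Rightarrow> 'a \<Rightarrow> bool" where
  "starts_run X u i \<omega> \<longleftrightarrow> \<not> upcross X u i \<omega> \<and> upcross X u (i + 2) \<omega>"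

text \<open>
  The summand at \<open>i\<close> of \<open>N_hat\<close> (with \<open>f = (\<lambda>_. 1)\<close>), of \<open>N_bar\<close> (with \<open>f = real\<close>), and of
  their truncations.
\<close>

definition mark :: "(nat \<Rightarrow> 'a \<Rightarrow> real) \<Rightarrow> real \<Rightarrow> (nat \<Rightarrow> real) \<Rightarrow> nat \<Rightarrow> 'a \<Rightarrow> real" where
  "mark X u f i \<omega> = f (run_length X u i \<omega>) * of_bool (starts_run X u i \<omega>)"

lemma upcross_count_single: "upcross_count X u m m \<omega> = of_bool (upcross X u m \<omega>)"
  by (simp add: upcross_count_def)

lemma run_length_is_iff:
  "run_length_is X u i \<omega> k \<longleftrightarrow>
     (\<forall>j\<in>{1..k}. upcross X u (i + 2 * j) \<omega>) \<and> \<not> upcross X u (i + 2 * k + 2) \<omega>"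
  by (simp add: run_length_is_def upcross_count_single)

lemma run_length_is_unique:
  assumes "run_length_is X u i \<omega> k" "run_length_is X u i \<omega> k'"
  shows "k = k'"
proof -
  have "\<not> k < k'" if a: "run_length_is X u i \<omega> k" "run_length_is X u i \<omega> k'" for k k'
  proof
    assume "k < k'"
    then have "Suc k \<in> {1..k'}" by auto
    with a(2) have "upcross X u (i + 2 * Suc k) \<omega>" unfolding run_length_is_iff by blast
    with a(1) show False unfolding run_length_is_iff by simp
  qed
  from this[OF assms] this[OF assms(2,1)] show ?thesis by simp
qed

lemma run_length_eqI: "run_length_is X u i \<omega> k \<Longrightarrow> run_length X u i \<omega> = k"
  unfolding run_length_def using run_length_is_unique by (metis (mono_tags, lifting) the_equality)

lemma run_length_eq_iff:
  assumes "1 \<le> k"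
  shows "run_length X u i \<omega> = k \<longleftrightarrow> run_length_is X u i \<omega> k"
  by (metis assms not_one_le_zero run_length_def run_length_eqI)

lemma run_start_iff: "\<omega> \<in> run_start M X u i \<longleftrightarrow> \<omega> \<in> space M \<and> starts_run X u i \<omega>"
  by (simp add: run_start_def starts_run_def upcross_count_single)

text \<open>
  The run cannot have length \<open>0\<close>, since there is an upcrossing at \<open>i + 2\<close>; the value \<open>0\<close> is
  then the default value for a run without end.
\<close>

lemma run_length_zero_imp_upcross:
  assumes "starts_run X u i \<omega>" "run_length X u i \<omega> = 0"
  shows "\<forall>j\<in>{1..k}. upcross X u (i + 2 * j) \<omega>"
proof -
  have no: "\<not> run_length_is X u i \<omega> k" for k
  proof
    assume a: "run_length_is X u i \<omega> k"
    then have "k = 0" using assms(2) run_length_eqI by fastforce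
    with a assms(1) show False by (simp add: run_length_is_iff starts_run_def)
  qed
  show ?thesis
  proof (induction k)
    case (Suc k)
    then have "upcross X u (i + 2 * k + 2) \<omega>" using no[of k] unfolding run_length_is_iff by blast
    with Suc show ?case by (auto simp: le_Suc_eq)
  qed simp
qed

lemma run_ge_iff:
  assumes "run_length X u i \<omega> \<noteq> 0"
  shows "(\<forall>j\<in>{1..k}. upcross X u (i + 2 * j) \<omega>) \<longleftrightarrow> k \<le> run_length X u i \<omega>"
proof -
  have r: "run_length_is X u i \<omega> (run_length X u i \<omega>)"
    using assms run_length_eq_iff[of "run_length X u i \<omega>" X u i \<omega>] by simp
  show ?thesis
  proof
    assume a: "\<forall>j\<in>{1..k}. upcross X u (i + 2 * j) \<omega>"
    show "k \<le> run_length X u i \<omega>"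
    proof (rule ccontr)
      assume "\<not> k \<le> run_length X u i \<omega>"
      then have "Suc (run_length X u i \<omega>) \<in> {1..k}" by simp
      with a have "upcross X u (i + 2 * Suc (run_length X u i \<omega>)) \<omega>" by blast
      with r show False unfolding run_length_is_iff by simp
    qed
  next
    assume "k \<le> run_length X u i \<omega>"
    with r show "\<forall>j\<in>{1..k}. upcross X u (i + 2 * j) \<omega>" unfolding run_length_is_iff by simp
  qed
qed

lemma upcross_shift:
  assumes "1 \<le> i"
  shows "upcross (\<lambda>i x. x i) u i (\<lambda>i\<in>{1..}. X (i + h) \<omega>) = upcross X u (i + h) \<omega>"
  using assms by (simp add: upcross_def)

text \<open>
  The left-hand side is the mark of the coordinate process at the shifted path. This form
  makes the invariance of the path distribution under shifts applicable to marks.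
\<close>

lemma mark_shift:
  assumes "1 \<le> i"
  shows "mark (\<lambda>i x. x i) u f i (\<lambda>i\<in>{1..}. X (i + h) \<omega>) = mark X u f (i + h) \<omega>"
proof -
  have e: "upcross (\<lambda>i x. x i) u (i + m) (\<lambda>i\<in>{1..}. X (i + h) \<omega>) = upcross X u (i + h + m) \<omega>" for m
    using upcross_shift[of "i + m" u X h \<omega>] assms by (simp add: ac_simps)
  have "run_length_is (\<lambda>i x. x i) u i (\<lambda>i\<in>{1..}. X (i + h) \<omega>) = run_length_is X u (i + h) \<omega>"
  proof
    fix k
    show "run_length_is (\<lambda>i x. x i) u i (\<lambda>i\<in>{1..}. X (i + h) \<omega>) k = run_length_is X u (i + h) \<omega> k"
      unfolding run_length_is_iff using e[of "2 * k + 2"] e by (simp add: add.assoc)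
  qed
  moreover have "starts_run (\<lambda>i x. x i) u i (\<lambda>i\<in>{1..}. X (i + h) \<omega>) = starts_run X u (i + h) \<omega>"
    unfolding starts_run_def using e[of 0] e[of 2] by simp
  ultimately show ?thesis unfolding mark_def run_length_def by auto
qed

lemmas upcross_shift_0 = upcross_shift[where h = 0, unfolded add_0_right]
  and mark_shift_0 = mark_shift[where h = 0, unfolded add_0_right]

lemma measurable_upcross:
  assumes "\<And>i. 1 \<le> i \<Longrightarrow> X i \<in> borel_measurable M" "1 \<le> i"
  shows "Measurable.pred M (upcross X u i)"
proof -
  have [measurable]: "X i \<in> borel_measurable M" "X (i + 1) \<in> borel_measurable M"
    using assms by auto
  show ?thesis unfolding upcross_def by measurable
qed

lemma measurable_run_length:
  assumes X: "\<And>i. 1 \<le> i \<Longrightarrow> X i \<in> borel_measurable M" "1 \<le> i"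
  shows "run_length X u i \<in> measurable M (count_space UNIV)"
proof -
  have up: "Measurable.pred M (upcross X u (i + m))" for m
    by (rule measurable_upcross) (use assms in auto)
  have R [measurable]: "Measurable.pred M (\<lambda>\<omega>. run_length_is X u i \<omega> k)" for k
  proof -
    note up[measurable]
    show ?thesis unfolding run_length_is_iff add.assoc by measurable
  qed
  have "run_length X u i = (\<lambda>\<omega>. if \<exists>k. run_length_is X u i \<omega> k then THE k. run_length_is X u i \<omega> k else 0)"
    by (simp add: run_length_def fun_eq_iff)
  also have "\<dots> \<in> measurable M (count_space UNIV)" 
  proof (intro measurable_If measurable_THE)
  qed (use R in \<open>auto dest: run_length_is_unique\<close>)
  finally show ?thesis .
qed

lemma measurable_starts_run:
  assumes X: "\<And>i. 1 \<le> i \<Longrightarrow> X i \<in> borel_measurable M" "1 \<le> i"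
  shows "Measurable.pred M (starts_run X u i)"
proof -
  have [measurable]: "Measurable.pred M (upcross X u i)" "Measurable.pred M (upcross X u (i + 2))"
    by (auto intro!: measurable_upcross assms)
  show ?thesis unfolding starts_run_def by measurable
qed

lemma measurable_mark:
  assumes X: "\<And>i. 1 \<le> i \<Longrightarrow> X i \<in> borel_measurable M" "1 \<le> i"
  shows "mark X u f i \<in> borel_measurable M"
proof -
  note measurable_starts_run[OF assms, measurable] measurable_run_length[OF assms, measurable]
  show ?thesis unfolding mark_def by measurable
qed

section \<open>Stationarity and the mean length of a run\<close>

locale stationary_sequence = prob_space M for M :: "'a measure" +
  fixes X :: "nat \<Rightarrow> 'a \<Rightarrow> real"
  assumes stationary: "stationary_seq M X"
begin

lemma X_measurable [measurable]: "1 \<le> i \<Longrightarrow> X i \<in> borel_measurable M"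
  using stationary by (simp add: stationary_seq_def)

lemma upcross_measurable: "1 \<le> i \<Longrightarrow> Measurable.pred M (upcross X u i)"
  and run_length_measurable: "1 \<le> i \<Longrightarrow> run_length X u i \<in> measurable M (count_space UNIV)"
  and starts_run_measurable: "1 \<le> i \<Longrightarrow> Measurable.pred M (starts_run X u i)"
  and mark_measurable: "1 \<le> i \<Longrightarrow> mark X u f i \<in> borel_measurable M"
  by (rule measurable_upcross measurable_run_length measurable_starts_run measurable_mark,
      erule X_measurable, assumption)+

lemma integral_shift:
  assumes G: "G \<in> borel_measurable (PiM {1..} (\<lambda>_. borel))"
  shows "(\<integral>\<omega>. (G (\<lambda>i\<in>{1..}. X (i + h) \<omega>) :: real) \<partial>M) = (\<integral>\<omega>. G (\<lambda>i\<in>{1..}. X (i + 0) \<omega>) \<partial>M)"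
proof -
  have m: "(\<lambda>\<omega>. \<lambda>i\<in>{1..}. X (i + h) \<omega>) \<in> measurable M (PiM {1..} (\<lambda>_. borel))" for h
    by (intro measurable_restrict) auto
  have "(\<integral>\<omega>. G (\<lambda>i\<in>{1..}. X (i + h) \<omega>) \<partial>M) = integral\<^sup>L (distr M (PiM {1..} (\<lambda>_. borel)) (\<lambda>\<omega>. \<lambda>i\<in>{1..}. X (i + h) \<omega>)) G"
    by (rule integral_distr[symmetric, OF m G])
  also have "\<dots> = integral\<^sup>L (distr M (PiM {1..} (\<lambda>_. borel)) (\<lambda>\<omega>. \<lambda>i\<in>{1..}. X (i + 0) \<omega>)) G"
    using stationary by (simp add: stationary_seq_def)
  also have "\<dots> = (\<integral>\<omega>. G (\<lambda>i\<in>{1..}. X (i + 0) \<omega>) \<partial>M)"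
    by (rule integral_distr[OF m G])
  finally show ?thesis .
qed

lemma integrable_shift:
  fixes G :: "(nat \<Rightarrow> real) \<Rightarrow> real"
  assumes G: "G \<in> borel_measurable (PiM {1..} (\<lambda>_. borel))"
  shows "integrable M (\<lambda>\<omega>. G (\<lambda>i\<in>{1..}. X (i + h) \<omega>)) \<longleftrightarrow> integrable M (\<lambda>\<omega>. G (\<lambda>i\<in>{1..}. X (i + 0) \<omega>))"
proof -
  have m: "(\<lambda>\<omega>. \<lambda>i\<in>{1..}. X (i + h) \<omega>) \<in> measurable M (PiM {1..} (\<lambda>_. borel))" for h
    by (intro measurable_restrict) auto
  have "distr M (PiM {1..} (\<lambda>_. borel)) (\<lambda>\<omega>. \<lambda>i\<in>{1..}. X (i + h) \<omega>)
    = distr M (PiM {1..} (\<lambda>_. borel)) (\<lambda>\<omega>. \<lambda>i\<in>{1..}. X (i + 0) \<omega>)"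
    using stationary by (simp add: stationary_seq_def)
  then show ?thesis
    using integrable_distr_eq[OF m G, of h] integrable_distr_eq[OF m G, of 0] by simp
qed

lemma coordinate_measurable: "1 \<le> i \<Longrightarrow> (\<lambda>x. x i) \<in> borel_measurable (PiM {1..} (\<lambda>_. borel))"
  by (rule measurable_component_singleton) simp

text \<open>
  The sum over a block of indices is a measurable functional of the path, the same one for
  each position of the block.
\<close>

lemma integral_marks_shift:
  assumes i: "\<And>i. i \<in> I \<Longrightarrow> 1 \<le> i" and F: "F \<in> borel_measurable borel"
  shows "(\<integral>\<omega>. F (\<Sum>i\<in>I. mark X u f (i + h) \<omega>) \<partial>M) = (\<integral>\<omega>. (F (\<Sum>i\<in>I. mark X u f i \<omega>) :: real) \<partial>M)"
proof -
  let ?P = "PiM {1..} (\<lambda>_. borel :: real measure)"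
  have [measurable]: "i \<in> I \<Longrightarrow> mark (\<lambda>i x. x i) u f i \<in> borel_measurable ?P" for i
    by (rule measurable_mark[OF coordinate_measurable]) (use i in auto)
  note F[measurable]
  have "(\<lambda>x. F (\<Sum>i\<in>I. mark (\<lambda>i x. x i) u f i x)) \<in> borel_measurable ?P" by measurable
  from integral_shift[OF this, of h] show ?thesis
    using i by (simp add: mark_shift mark_shift_0 del: One_nat_def cong: sum.cong)
qed

lemma integral_mark: "1 \<le> i \<Longrightarrow> (\<integral>\<omega>. mark X u f i \<omega> \<partial>M) = (\<integral>\<omega>. mark X u f 1 \<omega> \<partial>M)"
  using integral_marks_shift[of "{1}" "\<lambda>x. x" u f "i - 1"] by simp

lemma integrable_mark:
  assumes "integrable M (mark X u f 1)" "1 \<le> i"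
  shows "integrable M (mark X u f i)"
proof -
  have "mark (\<lambda>i x. x i) u f 1 \<in> borel_measurable (PiM {1..} (\<lambda>_. borel :: real measure))"
    by (rule measurable_mark[OF coordinate_measurable]) auto
  from integrable_shift[OF this, of "i - 1"] assms(1) have "integrable M (mark X u f (1 + (i - 1)))"
    by (simp only: mark_shift[OF order_refl] mark_shift_0[OF order_refl] add_0_right)
  then show ?thesis using assms(2) by simp
qed

definition up_block :: "real \<Rightarrow> nat \<Rightarrow> nat \<Rightarrow> 'a set" where
  "up_block u i m = {\<omega> \<in> space M. \<exists>j\<in>{i..<i+m}. upcross X u j \<omega>}"

lemma sets_Collect_upcross: "1 \<le> i \<Longrightarrow> {\<omega> \<in> space M. upcross X u i \<omega>} \<in> events"
  using upcross_measurable by measurable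

lemma sets_up_block: "1 \<le> i \<Longrightarrow> up_block u i m \<in> events"
proof -
  assume "1 \<le> i"
  then have "up_block u i m = (\<Union>j\<in>{i..<i+m}. {\<omega> \<in> space M. upcross X u j \<omega>})"
    "\<And>j. j \<in> {i..<i+m} \<Longrightarrow> {\<omega> \<in> space M. upcross X u j \<omega>} \<in> events"
    using sets_Collect_upcross by (auto simp: up_block_def)
  then show ?thesis by auto
qed

lemma prob_event_shift:
  assumes Q: "Measurable.pred (PiM {1..} (\<lambda>_. borel)) Q"
    and sh: "\<And>h \<omega>. Q (\<lambda>i\<in>{1..}. X (i + h) \<omega>) \<longleftrightarrow> R h \<omega>"
  shows "prob {\<omega> \<in> space M. R h \<omega>} = prob {\<omega> \<in> space M. R 0 \<omega>}"
proof -
  have "prob {\<omega> \<in> space M. R h \<omega>} = (\<integral>\<omega>. of_bool (R h \<omega>) \<partial>M)" for h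
  proof -
    have "prob {\<omega> \<in> space M. R h \<omega>} = (\<integral>\<omega>. indicator {\<omega>\<in>space M. R h \<omega>} \<omega> \<partial>M)"
      by (simp add: Int_absorb2 subset_iff)
    also have "\<dots> = (\<integral>\<omega>. of_bool (R h \<omega>) \<partial>M)"
      by (rule Bochner_Integration.integral_cong) (auto simp: indicator_def)
    finally show ?thesis .
  qed
  moreover have "(\<lambda>x. of_bool (Q x) :: real) \<in> borel_measurable (PiM {1..} (\<lambda>_. borel))"
    using Q by measurable
  from integral_shift[OF this, of h]
  have "(\<integral>\<omega>. (of_bool (R h \<omega>)::real) \<partial>M) = (\<integral>\<omega>. of_bool (R 0 \<omega>) \<partial>M)"
    unfolding sh .
  ultimately show ?thesis by simp
qed

lemma prob_up_block: "1 \<le> i \<Longrightarrow> prob (up_block u i m) = prob (up_block u 1 m)"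
proof -
  assume i: "1 \<le> i"
  let ?P = "PiM {1..} (\<lambda>_. borel :: real measure)"
  have [measurable]: "1 \<le> j \<Longrightarrow> Measurable.pred ?P (upcross (\<lambda>i x. x i) u j)" for j
    by (rule measurable_upcross[OF coordinate_measurable]) auto
  have "Measurable.pred ?P (\<lambda>x. \<exists>j\<in>{1..<1+m}. upcross (\<lambda>i x. x i) u j x)"
    by measurable
  from prob_event_shift[OF this, of "\<lambda>h \<omega>. \<exists>j\<in>{1..<1+m}. upcross X u (j+h) \<omega>" "i - 1"]
  have "prob {\<omega> \<in> space M. \<exists>j\<in>{1..<1+m}. upcross X u (j+(i-1)) \<omega>} = prob (up_block u 1 m)"
    by (simp add: upcross_shift upcross_shift_0 up_block_def del: One_nat_def)
  moreover have "(\<exists>j\<in>{1..<1+m}. upcross X u (j+(i-1)) \<omega>) \<longleftrightarrow> (\<exists>j\<in>{i..<i+m}. upcross X u j \<omega>)" for \<omega>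
  proof -
    have "{i..<i+m} = (\<lambda>j. j + (i-1)) ` {1..<1+m}" 
      using i by (subst image_add_atLeastLessThan') (simp add: add.commute)
    then show ?thesis by (metis (no_types, lifting) image_iff)
  qed
  ultimately show ?thesis by (simp add: up_block_def)
qed

text \<open>
  There is no condition at \<open>i\<close>, so such a chain may be the continuation of a run that starts
  earlier.
\<close>

definition all_up :: "real \<Rightarrow> nat \<Rightarrow> nat \<Rightarrow> 'a set" where
  "all_up u i k = {\<omega> \<in> space M. \<forall>j\<in>{1..k}. upcross X u (i + 2 * j) \<omega>}"

lemma sets_all_up: "all_up u i k \<in> events"
proof -
  have [measurable]: "j \<in> {1..k} \<Longrightarrow> Measurable.pred M (upcross X u (i + 2 * j))" for j
    by (rule upcross_measurable) auto
  have "Measurable.pred M (\<lambda>\<omega>. \<forall>j\<in>{1..k}. upcross X u (i + 2 * j) \<omega>)" by measurable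
  then show ?thesis unfolding all_up_def by measurable
qed

lemma prob_all_up: "prob (all_up u i k) = prob (all_up u 0 k)"
proof -
  let ?P = "PiM {1..} (\<lambda>_. borel :: real measure)"
  have [measurable]: "1 \<le> j \<Longrightarrow> Measurable.pred ?P (upcross (\<lambda>i x. x i) u j)" for j
    by (rule measurable_upcross[OF coordinate_measurable]) auto
  have "Measurable.pred ?P (\<lambda>x. \<forall>j\<in>{1..k}. upcross (\<lambda>i x. x i) u (2*j) x)"
    by measurable
  from prob_event_shift[OF this, of "\<lambda>h \<omega>. \<forall>j\<in>{1..k}. upcross X u (2*j+h) \<omega>" i]
  have "prob {\<omega> \<in> space M. \<forall>j\<in>{1..k}. upcross X u (2*j+i) \<omega>} = prob {\<omega> \<in> space M. \<forall>j\<in>{1..k}. upcross X u (2*j) \<omega>}"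
    by (simp add: upcross_shift upcross_shift_0 del: One_nat_def)
  then show ?thesis by (simp add: all_up_def add.commute)
qed

text \<open>
  A run that starts at \<open>1\<close> and has length at least \<open>k\<close> is a chain of \<open>k\<close> upcrossings that does
  not extend to the left. By stationarity, the chains that do extend have the probability of a
  chain of \<open>k + 1\<close> upcrossings. The sum over \<open>k\<close> therefore telescopes.
\<close>

lemma prob_run_ge:
  assumes "1 \<le> k"
  shows "prob (all_up u 1 k \<inter> {\<omega> \<in> space M. starts_run X u 1 \<omega>})
           = prob (all_up u 0 k) - prob (all_up u 0 (Suc k))"
proof -
  define B where "B = {\<omega> \<in> space M. upcross X u 1 \<omega>} \<inter> all_up u 1 k"
  have B: "prob B = prob (all_up u 0 (Suc k))"
  proof -
    let ?P = "PiM {1..} (\<lambda>_. borel :: real measure)"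
    have [measurable]: "1 \<le> j \<Longrightarrow> Measurable.pred ?P (upcross (\<lambda>i x. x i) u j)" for j
      by (rule measurable_upcross[OF coordinate_measurable]) auto
    have "Measurable.pred ?P (\<lambda>x. \<forall>j\<in>{0..k}. upcross (\<lambda>i x. x i) u (2*j+1) x)"
      by measurable
    from prob_event_shift[OF this, of "\<lambda>h \<omega>. \<forall>j\<in>{0..k}. upcross X u (2*j+1+h) \<omega>" 1]
    have *: "prob {\<omega> \<in> space M. \<forall>j\<in>{0..k}. upcross X u (2*j+2) \<omega>}
      = prob {\<omega> \<in> space M. \<forall>j\<in>{0..k}. upcross X u (2*j+1) \<omega>}"
      by (simp add: upcross_shift upcross_shift_0 del: One_nat_def)
    have "{1..Suc k} = Suc ` {0..k}" by (simp add: image_Suc_atLeastAtMost)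
    then have "all_up u 0 (Suc k) = {\<omega> \<in> space M. \<forall>j\<in>{0..k}. upcross X u (2*j+2) \<omega>}"
      unfolding all_up_def by (simp add: ac_simps del: image_Suc_atLeastAtMost)
    moreover have "{0..k} = insert 0 {1..k}" by auto
    then have "B = {\<omega> \<in> space M. \<forall>j\<in>{0..k}. upcross X u (2*j+1) \<omega>}"
      unfolding all_up_def B_def by auto
    ultimately show ?thesis using * by simp
  qed
  have "upcross X u (1 + 2) \<omega>" if "\<omega> \<in> all_up u 1 k" for \<omega>
  proof -
    have "\<forall>j\<in>{1..k}. upcross X u (1 + 2 * j) \<omega>" using that by (simp add: all_up_def)
    then have "upcross X u (1 + 2 * 1) \<omega>" using assms by (rule_tac bspec) auto
    then show ?thesis by simp
  qed
  moreover have "all_up u 1 k \<subseteq> space M" by (auto simp: all_up_def)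
  ultimately have "all_up u 1 k \<inter> {\<omega> \<in> space M. starts_run X u 1 \<omega>} = all_up u 1 k - B"
    unfolding B_def starts_run_def by blast
  also have "prob \<dots> = prob (all_up u 1 k) - prob B"
    by (rule finite_measure_Diff) (auto simp: B_def sets_all_up intro!: sets.Int sets_Collect_upcross)
  finally show ?thesis using B prob_all_up[of u 1 k] by simp
qed

text \<open>
  A run without end is contained in a chain of \<open>k\<close> upcrossings for every \<open>k\<close>.
\<close>

lemma runs_almost_surely_finite:
  assumes "(\<lambda>j. prob (all_up u 0 j)) \<longlonglongrightarrow> 0" and i: "1 \<le> i"
  shows "AE \<omega> in M. starts_run X u i \<omega> \<longrightarrow> run_length X u i \<omega> \<noteq> 0"
proof -
  define E where "E = {\<omega> \<in> space M. starts_run X u i \<omega> \<and> run_length X u i \<omega> = 0}"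
  have [measurable]: "Measurable.pred M (starts_run X u i)" "run_length X u i \<in> measurable M (count_space UNIV)"
    using starts_run_measurable[OF i] run_length_measurable[OF i] by auto
  have E: "E \<in> events" unfolding E_def by measurable
  have "prob E \<le> prob (all_up u 0 k)" for k
  proof -
    have "E \<subseteq> all_up u i k" 
      unfolding E_def all_up_def using run_length_zero_imp_upcross[of X u i] by auto
    then have "prob E \<le> prob (all_up u i k)" by (rule finite_measure_mono[OF _ sets_all_up])
    then show ?thesis using prob_all_up[of u i k] by simp
  qed
  then have "prob E \<le> 0" using LIMSEQ_le_const[OF assms(1)] by blast
  then have "prob E = 0" by (simp add: measure_le_0_iff)
  then have "emeasure M E = 0" by (simp add: emeasure_eq_measure)
  then show ?thesis using E by (subst AE_iff_measurable[of E]) (auto simp: E_def)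
qed

text \<open>
  The mean of a run length is the sum over \<open>k \<ge> 1\<close> of the probabilities that it is at least
  \<open>k\<close>, which telescopes by \<open>prob_run_ge\<close>.
\<close>

lemma run_mean:
  assumes lim: "(\<lambda>j. prob (all_up u 0 j)) \<longlonglongrightarrow> 0"
  shows "has_bochner_integral M (mark X u real 1) (prob {\<omega> \<in> space M. upcross X u 1 \<omega>})"
proof -
  define S where "S = {\<omega> \<in> space M. starts_run X u 1 \<omega>}"
  define B where "B k = all_up u 1 (Suc k) \<inter> S" for k
  have S: "S \<in> events" unfolding S_def using starts_run_measurable[of 1 u] by measurable
  have B: "B k \<in> events" for k using S sets_all_up by (auto simp: B_def)
  have tele: "(\<lambda>k. prob (B k)) sums prob (all_up u 0 1)"
  proof -
    have "(\<lambda>j. prob (all_up u 0 (Suc j))) \<longlonglongrightarrow> 0" using lim by (rule LIMSEQ_Suc)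
    from telescope_sums'[OF this]
    show ?thesis using prob_run_ge by (simp add: B_def S_def)
  qed
  have p: "prob (all_up u 0 1) = prob {\<omega> \<in> space M. upcross X u 1 \<omega>}"
    using prob_up_block[of 2 u 1] by (simp add: all_up_def up_block_def numeral_2_eq_2)
  have "(\<integral>\<^sup>+\<omega>. ennreal (mark X u real 1 \<omega>) \<partial>M) = (\<integral>\<^sup>+\<omega>. (\<Sum>k. indicator (B k) \<omega>) \<partial>M)"
  proof (rule nn_integral_cong_AE)
    show "AE \<omega> in M. ennreal (mark X u real 1 \<omega>) = (\<Sum>k. indicator (B k) \<omega>)"
      using runs_almost_surely_finite[OF lim order_refl] AE_space
    proof eventually_elim
      case (elim \<omega>)
      show ?case
      proof (cases "starts_run X u 1 \<omega>")
        case True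
        let ?y = "run_length X u 1 \<omega>"
        have i: "indicator (B k) \<omega> = (if k \<in> {..<?y} then 1 else 0 :: ennreal)" for k
          using True run_ge_iff[of X u 1 \<omega> "Suc k"] elim by (auto simp: B_def S_def all_up_def)
        have "(\<Sum>k. indicator (B k) \<omega> :: ennreal) = (\<Sum>k<?y. 1)"
          unfolding i by (subst suminf_finite[of "{..<?y}"]) auto
        then show ?thesis using True by (simp add: mark_def ennreal_of_nat_eq_real_of_nat)
      next
        case False
        have "(\<Sum>k. indicator (B k) \<omega> :: ennreal) = 0" using False by (simp add: B_def S_def)
        then show ?thesis using False by (simp add: mark_def)
      qed
    qed
  qed
  also have "\<dots> = (\<Sum>k. emeasure M (B k))"
    using B by (subst nn_integral_suminf) auto
  also have "\<dots> = ennreal (prob (all_up u 0 1))"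
    unfolding emeasure_eq_measure using tele by (intro suminf_ennreal_eq) auto
  finally show ?thesis
    using mark_measurable[of 1 u real] p
    by (intro has_bochner_integral_nn_integral) (auto simp: mark_def)
qed

end

section \<open>Laplace transforms and convergence in probability\<close>

lemma exp_neg_le_quadratic:
  fixes x :: real assumes "0 \<le> x" shows "exp (- x) \<le> 1 - x + x\<^sup>2 / 2"
proof -
  have "1 \<le> 1 + (x\<^sup>2)\<^sup>2 / 4" by simp
  also have "\<dots> = (1 - x + x\<^sup>2 / 2) * (1 + x + x\<^sup>2 / 2)"
    by (simp add: algebra_simps power2_eq_square)
  also have "\<dots> \<le> (1 - x + x\<^sup>2 / 2) * exp x"
  proof (rule mult_left_mono[OF exp_lower_Taylor_quadratic[OF assms]])
    have "0 \<le> (1 - x)\<^sup>2 + 1" by simp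
    then show "0 \<le> 1 - x + x\<^sup>2 / 2" by (simp add: power2_eq_square algebra_simps)
  qed
  finally show ?thesis by (simp add: exp_minus field_simps)
qed

text \<open>
  From \<open>1 - q \<le> - ln q \<le> (1 - q) / q\<close>, where \<open>q n\<close> tends to \<open>1\<close>.
\<close>

lemma power_tendsto_exp:
  fixes q :: "nat \<Rightarrow> real"
  assumes k: "filterlim k at_top sequentially"
    and lim: "(\<lambda>n. real (k n) * (1 - q n)) \<longlonglongrightarrow> x"
  shows "(\<lambda>n. q n ^ k n) \<longlonglongrightarrow> exp (- x)"
proof -
  have kr: "filterlim (\<lambda>n. real (k n)) at_top sequentially"
    by (rule filterlim_compose[OF filterlim_real_sequentially k])
  have "(\<lambda>n. (real (k n) * (1 - q n)) * inverse (real (k n))) \<longlonglongrightarrow> x * 0"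
    by (intro tendsto_mult lim tendsto_inverse_0_at_top kr)
  moreover have "\<forall>\<^sub>F n in sequentially. k n > 0"
    by (rule eventually_compose_filterlim[OF eventually_gt_at_top k])
  ultimately have "(\<lambda>n. 1 - q n) \<longlonglongrightarrow> 0"
    by (auto elim!: Lim_transform_eventually eventually_mono)
  then have "(\<lambda>n. 1 - (1 - q n)) \<longlonglongrightarrow> 1 - 0" by (intro tendsto_intros)
  then have q1: "q \<longlonglongrightarrow> 1" by simp
  then have pos: "\<forall>\<^sub>F n in sequentially. 0 < q n" by (rule order_tendstoD) simp
  have "(\<lambda>n. real (k n) * ln (q n)) \<longlonglongrightarrow> - x"
  proof (rule tendsto_sandwich)
    show "\<forall>\<^sub>F n in sequentially. - ((real (k n) * (1 - q n)) / q n) \<le> real (k n) * ln (q n)"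
      using pos
    proof eventually_elim
      case (elim n)
      have "ln (1 / q n) \<le> 1 / q n - 1" using elim by (intro ln_le_minus_one) simp
      then have "- ((1 - q n) / q n) \<le> ln (q n)" using elim by (simp add: ln_div diff_divide_distrib)
      from mult_left_mono[OF this, of "real (k n)"] show ?case by simp
    qed
    show "\<forall>\<^sub>F n in sequentially. real (k n) * ln (q n) \<le> - (real (k n) * (1 - q n))"
      using pos
    proof eventually_elim
      case (elim n)
      from mult_left_mono[OF ln_le_minus_one[OF elim], of "real (k n)"]
      show ?case by (simp add: algebra_simps)
    qed
    show "(\<lambda>n. - ((real (k n) * (1 - q n)) / q n)) \<longlonglongrightarrow> - x"
      using tendsto_minus[OF tendsto_divide[OF lim q1]] by simp
    show "(\<lambda>n. - (real (k n) * (1 - q n))) \<longlonglongrightarrow> - x" by (intro tendsto_minus lim)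
  qed
  then have "(\<lambda>n. exp (real (k n) * ln (q n))) \<longlonglongrightarrow> exp (- x)" by (rule tendsto_exp)
  moreover have "\<forall>\<^sub>F n in sequentially. exp (real (k n) * ln (q n)) = q n ^ k n"
    using pos by eventually_elim (simp add: exp_of_nat_mult)
  ultimately show ?thesis by (rule Lim_transform_eventually)
qed

context prob_space begin

text \<open>
  Up to an error of at most \<open>1 / m\<close>, a function with values in the unit interval is the
  average of the indicators of its superlevel sets at \<open>q / m\<close> for \<open>q = 1, \<dots>, m\<close>. The
  covariance of two such averages is an average of covariances of events.
\<close>

lemma covariance_le:
  fixes f g :: "'a \<Rightarrow> real"
  assumes [measurable]: "f \<in> borel_measurable M" "g \<in> borel_measurable M"
    and f01: "\<And>\<omega>. 0 \<le> f \<omega> \<and> f \<omega> \<le> 1" and g01: "\<And>\<omega>. 0 \<le> g \<omega> \<and> g \<omega> \<le> 1"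
    and cov: "\<And>s t. \<bar>prob ({\<omega> \<in> space M. s \<le> f \<omega>} \<inter> {\<omega> \<in> space M. t \<le> g \<omega>})
                - prob {\<omega> \<in> space M. s \<le> f \<omega>} * prob {\<omega> \<in> space M. t \<le> g \<omega>}\<bar> \<le> \<alpha>"
  shows "\<bar>expectation (\<lambda>\<omega>. f \<omega> * g \<omega>) - expectation f * expectation g\<bar> \<le> \<alpha>"
proof -
  define A where "A q m = {\<omega> \<in> space M. real q / real m \<le> f \<omega>}" for q m :: nat
  define B where "B q m = {\<omega> \<in> space M. real q / real m \<le> g \<omega>}" for q m :: nat
  have [measurable, simp]: "A q m \<in> events" "B q m \<in> events" for q m
    unfolding A_def B_def by measurable
  define F where "F m \<omega> = (\<Sum>q=1..m. indicator (A q m) \<omega> :: real) / real m" for m \<omega>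
  define G where "G m \<omega> = (\<Sum>q=1..m. indicator (B q m) \<omega> :: real) / real m" for m \<omega>
  have approx: "0 \<le> S \<and> S \<le> 1 \<and> \<bar>S - x\<bar> \<le> 1 / real m"
    if "0 < m" "0 \<le> x" "x \<le> 1" "S = (\<Sum>q=1..m. of_bool (real q / real m \<le> x)) / real m"
    for m :: nat and x S :: real
  proof -
    define y where "y = nat \<lfloor>x * real m\<rfloor>"
    have y: "real y \<le> x * real m" "x * real m < real y + 1" using that by (auto simp: y_def)
    have "real y \<le> real m" using y(1) that(3) mult_right_mono[of x 1 "real m"] by simp
    then have ym: "y \<le> m" by (simp only: of_nat_le_iff)
    have "real q / real m \<le> x \<longleftrightarrow> q \<le> y" for q
    proof -
      have "real q / real m \<le> x \<longleftrightarrow> real q \<le> x * real m" using that by (simp add: field_simps)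
      also have "\<dots> \<longleftrightarrow> q \<le> y" using that by (simp add: y_def le_nat_floor le_nat_iff le_floor_iff)
      finally show ?thesis .
    qed
    then have "(\<Sum>q=1..m. of_bool (real q / real m \<le> x)) = (\<Sum>q=1..m. of_bool (q \<le> y) :: real)"
      by (intro sum.cong) auto
    also have "\<dots> = real (card ({1..m} \<inter> {q. q \<le> y}))" by simp
    also have "{1..m} \<inter> {q. q \<le> y} = {1..y}" using ym by auto
    finally have S: "S = real y / real m" using that by simp
    have "real y / real m \<le> x" "x \<le> (real y + 1) / real m"
      using y \<open>0 < m\<close> by (simp_all add: field_simps)
    moreover have "real y / real m \<le> 1" using ym \<open>0 < m\<close> by simp
    ultimately show ?thesis unfolding S by (simp add: abs_le_iff add_divide_distrib)
  qed
  have F: "0 \<le> F m \<omega> \<and> F m \<omega> \<le> 1 \<and> \<bar>F m \<omega> - f \<omega>\<bar> \<le> 1 / real m" if "0 < m" "\<omega> \<in> space M" for m \<omega>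
    by (rule approx) (use that f01 in \<open>auto simp: F_def A_def indicator_def\<close>)
  have G: "0 \<le> G m \<omega> \<and> G m \<omega> \<le> 1 \<and> \<bar>G m \<omega> - g \<omega>\<bar> \<le> 1 / real m" if "0 < m" "\<omega> \<in> space M" for m \<omega>
    by (rule approx) (use that g01 in \<open>auto simp: G_def B_def indicator_def\<close>)
  have [measurable]: "F m \<in> borel_measurable M" "G m \<in> borel_measurable M" for m
    unfolding F_def[abs_def] G_def[abs_def] by measurable
  have conv: "(\<lambda>m. H m \<omega>) \<longlonglongrightarrow> h \<omega>"
    if "\<And>m. 0 < m \<Longrightarrow> \<bar>H m \<omega> - h \<omega>\<bar> \<le> 1 / real m" for H :: "nat \<Rightarrow> 'a \<Rightarrow> real" and h \<omega>
  proof (rule LIM_zero_cancel, rule Lim_null_comparison)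
    show "\<forall>\<^sub>F m in sequentially. norm (H m \<omega> - h \<omega>) \<le> 1 / real m"
      using eventually_gt_at_top[of 0] by eventually_elim (use that in auto)
    show "(\<lambda>m. 1 / real m) \<longlonglongrightarrow> 0" by (rule lim_1_over_n)
  qed
  have cF: "\<omega> \<in> space M \<Longrightarrow> (\<lambda>m. F (Suc m) \<omega>) \<longlonglongrightarrow> f \<omega>" for \<omega>
    by (rule LIMSEQ_Suc[OF conv]) (use F in auto)
  have cG: "\<omega> \<in> space M \<Longrightarrow> (\<lambda>m. G (Suc m) \<omega>) \<longlonglongrightarrow> g \<omega>" for \<omega>
    by (rule LIMSEQ_Suc[OF conv]) (use G in auto)
  have limF: "(\<lambda>m. expectation (F (Suc m))) \<longlonglongrightarrow> expectation f"
    by (rule integral_dominated_convergence[where w = "\<lambda>_. 1"]) (use F cF in auto)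
  have limG: "(\<lambda>m. expectation (G (Suc m))) \<longlonglongrightarrow> expectation g"
    by (rule integral_dominated_convergence[where w = "\<lambda>_. 1"]) (use G cG in auto)
  have limFG: "(\<lambda>m. expectation (\<lambda>\<omega>. F (Suc m) \<omega> * G (Suc m) \<omega>)) \<longlonglongrightarrow> expectation (\<lambda>\<omega>. f \<omega> * g \<omega>)"
    by (rule integral_dominated_convergence[where w = "\<lambda>_. 1"])
       (use F G cF cG in \<open>auto intro!: tendsto_mult mult_le_one simp: abs_mult\<close>)
  have bound: "\<bar>expectation (\<lambda>\<omega>. F m \<omega> * G m \<omega>) - expectation (F m) * expectation (G m)\<bar> \<le> \<alpha>" if "0 < m" for m
  proof -
    have int_ind: "integrable M (indicator D :: 'a \<Rightarrow> real)" if "D \<in> events" for D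
      using that by (auto simp: less_top[symmetric])
    have eF: "expectation (F m) = (\<Sum>q=1..m. prob (A q m)) / m"
      unfolding F_def by (simp add: int_ind)
    have eG: "expectation (G m) = (\<Sum>q=1..m. prob (B q m)) / m"
      unfolding G_def by (simp add: int_ind)
    have "expectation (\<lambda>\<omega>. F m \<omega> * G m \<omega>) = expectation (\<lambda>\<omega>. (\<Sum>p=1..m. \<Sum>q=1..m. indicator (A p m \<inter> B q m) \<omega>) / m^2)"
      unfolding F_def G_def by (simp add: sum_product indicator_inter_arith power2_eq_square)
    also have "\<dots> = (\<Sum>p=1..m. \<Sum>q=1..m. prob (A p m \<inter> B q m)) / m^2"
      by (simp add: int_ind)
    finally have "expectation (\<lambda>\<omega>. F m \<omega> * G m \<omega>) - expectation (F m) * expectation (G m)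
      = (\<Sum>p=1..m. \<Sum>q=1..m. prob (A p m \<inter> B q m) - prob (A p m) * prob (B q m)) / m^2"
      unfolding eF eG by (simp add: sum_product power2_eq_square diff_divide_distrib sum_subtractf)
    also have "\<bar>\<dots>\<bar> \<le> (\<Sum>p=1..m. \<Sum>q=1..m. \<alpha>) / m^2"
      unfolding abs_divide
      by (intro divide_mono order.trans[OF sum_abs] sum_mono)
         (use cov that in \<open>auto simp: A_def B_def intro!: sum_nonneg\<close>)
    also have "\<dots> = \<alpha>" using that by (simp add: power2_eq_square)
    finally show ?thesis .
  qed
  show ?thesis
    by (rule LIMSEQ_le_const2[OF tendsto_rabs[OF tendsto_diff[OF limFG tendsto_mult[OF limF limG]]]])
       (use bound in auto)
qed

text \<open>
  The two limits say that \<open>exp (- S n)\<close> converges to \<open>exp (- a)\<close> in mean square, hence in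
  probability by the Markov inequality.
\<close>

lemma tendsto_in_prob_of_laplace:
  assumes [measurable]: "\<And>n. S n \<in> borel_measurable M"
    and nn: "\<And>n \<omega>. 0 \<le> S n \<omega>"
    and lim: "\<And>s. s \<in> {1, 2} \<Longrightarrow> (\<lambda>n. expectation (\<lambda>\<omega>. exp (- (s * S n \<omega>)))) \<longlonglongrightarrow> exp (- (s * a))"
  shows "tendsto_in_prob M S a"
  unfolding tendsto_in_prob_def
proof (intro allI impI)
  fix \<epsilon> :: real assume "\<epsilon> > 0"
  define b where "b = exp (- a)"
  \<comment> \<open>The distance of \<open>exp (- a)\<close> from \<open>exp (- a - \<epsilon>)\<close>; that from \<open>exp (- a + \<epsilon>)\<close> is larger by convexity.\<close>
  define \<delta> where "\<delta> = b * (1 - exp (- \<epsilon>))"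
  have \<delta>: "\<delta> > 0" using \<open>\<epsilon> > 0\<close> by (simp add: \<delta>_def b_def)
  have far: "\<delta> \<le> \<bar>exp (- x) - b\<bar>" if "\<bar>x - a\<bar> > \<epsilon>" for x
  proof (cases "x > a")
    case True
    then have "exp (- x) \<le> exp (- a - \<epsilon>)" using that by simp
    also have "\<dots> = b - \<delta>" by (simp add: b_def \<delta>_def algebra_simps exp_diff exp_minus field_simps)
    finally show ?thesis by simp
  next
    case False
    then have "exp (- a + \<epsilon>) \<le> exp (- x)" using that by simp
    then have "b * exp \<epsilon> \<le> exp (- x)" by (simp add: b_def exp_add[symmetric])
    moreover have "1 - exp (- \<epsilon>) \<le> exp \<epsilon> - 1"
      using exp_ge_add_one_self[of "\<epsilon>"] exp_ge_add_one_self[of "- \<epsilon>"] by linarith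
    then have "\<delta> \<le> b * (exp \<epsilon> - 1)" unfolding \<delta>_def by (intro mult_left_mono) (auto simp: b_def)
    ultimately show ?thesis by (simp add: algebra_simps)
  qed
  have int: "integrable M (\<lambda>\<omega>. exp (- (s * S n \<omega>)))" if "s \<in> {1,2}" for s n
    by (rule integrable_const_bound[where B = 1]) (use nn that in auto)
  define V where "V n = expectation (\<lambda>\<omega>. (exp (- S n \<omega>) - b)\<^sup>2)" for n
  have sq: "(exp (- S n \<omega>) - b)\<^sup>2 = exp (- (2 * S n \<omega>)) - 2 * b * exp (- (1 * S n \<omega>)) + b\<^sup>2" for n \<omega>
    by (simp add: power2_eq_square algebra_simps flip: exp_add)
  have intV: "integrable M (\<lambda>\<omega>. (exp (- S n \<omega>) - b)\<^sup>2)" for n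
    unfolding sq using int[of 1 n] int[of 2 n] by (intro Bochner_Integration.integrable_add Bochner_Integration.integrable_diff integrable_mult_right) auto
  have "V = (\<lambda>n. expectation (\<lambda>\<omega>. exp (- (2 * S n \<omega>))) - 2 * b * expectation (\<lambda>\<omega>. exp (- (1 * S n \<omega>))) + b\<^sup>2)"
    unfolding V_def sq using int[of 1] int[of 2] by (simp add: prob_space)
  moreover have "(\<lambda>n. expectation (\<lambda>\<omega>. exp (- (2 * S n \<omega>))) - 2 * b * expectation (\<lambda>\<omega>. exp (- (1 * S n \<omega>))) + b\<^sup>2)
    \<longlonglongrightarrow> exp (- (2 * a)) - 2 * b * exp (- (1 * a)) + b\<^sup>2"
    by (intro tendsto_intros lim) auto
  moreover have "exp (- (2 * a)) - 2 * b * exp (- (1 * a)) + b\<^sup>2 = 0"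
    by (simp add: b_def power2_eq_square flip: exp_add)
  ultimately have V0: "V \<longlonglongrightarrow> 0" by simp
  show "(\<lambda>n. prob {\<omega> \<in> space M. \<epsilon> < \<bar>S n \<omega> - a\<bar>}) \<longlonglongrightarrow> 0"
  proof (rule tendsto_sandwich[of "\<lambda>_. 0" _ _ "\<lambda>n. V n / \<delta>\<^sup>2"])
    show "(\<lambda>n. V n / \<delta>\<^sup>2) \<longlonglongrightarrow> 0" using tendsto_divide[OF V0 tendsto_const, of "\<delta>\<^sup>2"] \<delta> by simp
    show "\<forall>\<^sub>F n in sequentially. prob {\<omega> \<in> space M. \<epsilon> < \<bar>S n \<omega> - a\<bar>} \<le> V n / \<delta>\<^sup>2"
    proof (intro always_eventually allI)
      fix n
      have "prob {\<omega> \<in> space M. \<epsilon> < \<bar>S n \<omega> - a\<bar>} \<le> prob {\<omega> \<in> space M. \<delta>\<^sup>2 \<le> (exp (- S n \<omega>) - b)\<^sup>2}"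
      proof (rule finite_measure_mono)
        show "{\<omega> \<in> space M. \<epsilon> < \<bar>S n \<omega> - a\<bar>} \<subseteq> {\<omega> \<in> space M. \<delta>\<^sup>2 \<le> (exp (- S n \<omega>) - b)\<^sup>2}"
          using far \<delta> by (auto simp: abs_le_square_iff[symmetric])
      qed measurable
      also have "\<dots> \<le> V n / \<delta>\<^sup>2"
        unfolding V_def using \<delta> by (intro integral_Markov_inequality_measure[OF intV, of "{}"]) auto
      finally show "prob {\<omega> \<in> space M. \<epsilon> < \<bar>S n \<omega> - a\<bar>} \<le> V n / \<delta>\<^sup>2" .
    qed
  qed auto
qed

lemma tendsto_in_prob_of_L1:
  assumes W: "\<And>n. W n \<in> borel_measurable M" and S: "\<And>n. S n \<in> borel_measurable M"
    and lim: "tendsto_in_prob M S a"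
    and L1: "\<forall>\<^sub>F n in sequentially. integrable M (\<lambda>\<omega>. W n \<omega> - S n \<omega>) \<and> expectation (\<lambda>\<omega>. \<bar>W n \<omega> - S n \<omega>\<bar>) \<le> d n"
    and d: "d \<longlonglongrightarrow> 0"
  shows "tendsto_in_prob M W a"
  unfolding tendsto_in_prob_def
proof (intro allI impI)
  fix \<epsilon> :: real assume \<epsilon>: "\<epsilon> > 0"
  note W[measurable] S[measurable]
  show "(\<lambda>n. prob {\<omega> \<in> space M. \<epsilon> < \<bar>W n \<omega> - a\<bar>}) \<longlonglongrightarrow> 0"
  proof (rule tendsto_sandwich[of "\<lambda>_. 0" _ _ "\<lambda>n. prob {\<omega> \<in> space M. \<epsilon> / 2 < \<bar>S n \<omega> - a\<bar>} + d n / (\<epsilon> / 2)"])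
    have "(\<lambda>n. prob {\<omega> \<in> space M. \<epsilon> / 2 < \<bar>S n \<omega> - a\<bar>}) \<longlonglongrightarrow> 0"
      using lim[unfolded tendsto_in_prob_def, rule_format, of "\<epsilon> / 2"] \<epsilon> by simp
    from tendsto_add[OF this tendsto_divide[OF d tendsto_const, of "\<epsilon>/2"]] \<epsilon>
    show "(\<lambda>n. prob {\<omega> \<in> space M. \<epsilon> / 2 < \<bar>S n \<omega> - a\<bar>} + d n / (\<epsilon> / 2)) \<longlonglongrightarrow> 0" by simp
    show "\<forall>\<^sub>F n in sequentially. prob {\<omega> \<in> space M. \<epsilon> < \<bar>W n \<omega> - a\<bar>}
      \<le> prob {\<omega> \<in> space M. \<epsilon> / 2 < \<bar>S n \<omega> - a\<bar>} + d n / (\<epsilon> / 2)"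
      using L1
    proof eventually_elim
      case (elim n)
      have "prob {\<omega> \<in> space M. \<epsilon> < \<bar>W n \<omega> - a\<bar>}
        \<le> prob ({\<omega> \<in> space M. \<epsilon> / 2 < \<bar>S n \<omega> - a\<bar>} \<union> {\<omega> \<in> space M. \<epsilon> / 2 \<le> \<bar>W n \<omega> - S n \<omega>\<bar>})"
      proof (rule finite_measure_mono)
        show "{\<omega> \<in> space M. \<epsilon> < \<bar>W n \<omega> - a\<bar>}
          \<subseteq> {\<omega> \<in> space M. \<epsilon> / 2 < \<bar>S n \<omega> - a\<bar>} \<union> {\<omega> \<in> space M. \<epsilon> / 2 \<le> \<bar>W n \<omega> - S n \<omega>\<bar>}"
          by (intro subsetI, simp) (smt (verit, best) \<epsilon>)
      qed measurable
      also have "\<dots> \<le> prob {\<omega> \<in> space M. \<epsilon> / 2 < \<bar>S n \<omega> - a\<bar>} + prob {\<omega> \<in> space M. \<epsilon> / 2 \<le> \<bar>W n \<omega> - S n \<omega>\<bar>}"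
        by (rule measure_Un_le) measurable
      also have "prob {\<omega> \<in> space M. \<epsilon> / 2 \<le> \<bar>W n \<omega> - S n \<omega>\<bar>} \<le> expectation (\<lambda>\<omega>. \<bar>W n \<omega> - S n \<omega>\<bar>) / (\<epsilon> / 2)"
        using elim \<epsilon> by (intro integral_Markov_inequality_measure[of _ _ "{}"]) auto
      also have "\<dots> \<le> d n / (\<epsilon> / 2)" using elim \<epsilon> by (intro divide_right_mono) auto
      finally show ?case by simp
    qed
  qed auto
qed

lemma tendsto_in_prob_divide:
  assumes V: "\<And>n. V n \<in> borel_measurable M" and W: "\<And>n. W n \<in> borel_measurable M"
    and limV: "tendsto_in_prob M V a" and limW: "tendsto_in_prob M W b" and "b \<noteq> 0"
  shows "tendsto_in_prob M (\<lambda>n \<omega>. V n \<omega> / W n \<omega>) (a / b)"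
  unfolding tendsto_in_prob_def
proof (intro allI impI)
  fix \<epsilon> :: real assume \<epsilon>: "\<epsilon> > 0"
  note W[measurable] V[measurable]
  have "continuous (at (a, b)) (\<lambda>z. fst z / snd z)"
    using \<open>b \<noteq> 0\<close> by (intro continuous_intros) auto
  then obtain d where d: "d > 0" "\<And>z. dist z (a, b) < d \<Longrightarrow> dist (fst z / snd z) (a / b) < \<epsilon>"
    using \<epsilon> unfolding continuous_at_eps_delta by force
  have near: "\<bar>x / y - a / b\<bar> < \<epsilon>" if "\<bar>x - a\<bar> \<le> d / 3" "\<bar>y - b\<bar> \<le> d / 3" for x y
  proof -
    have "dist (x, y) (a, b) \<le> \<bar>x - a\<bar> + \<bar>y - b\<bar>"
      unfolding dist_Pair_Pair dist_real_def by (rule order.trans[OF sqrt_sum_squares_le_sum_abs]) simp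
    then show ?thesis using d(2)[of "(x, y)"] d(1) that by (simp add: dist_real_def)
  qed
  show "(\<lambda>n. prob {\<omega> \<in> space M. \<epsilon> < \<bar>V n \<omega> / W n \<omega> - a / b\<bar>}) \<longlonglongrightarrow> 0"
  proof (rule tendsto_sandwich[of "\<lambda>_. 0" _ _ "\<lambda>n. prob {\<omega> \<in> space M. d / 3 < \<bar>V n \<omega> - a\<bar>} + prob {\<omega> \<in> space M. d / 3 < \<bar>W n \<omega> - b\<bar>}"])
    show "(\<lambda>n. prob {\<omega> \<in> space M. d / 3 < \<bar>V n \<omega> - a\<bar>} + prob {\<omega> \<in> space M. d / 3 < \<bar>W n \<omega> - b\<bar>}) \<longlonglongrightarrow> 0"
      using limV[unfolded tendsto_in_prob_def, rule_format, of "d / 3"]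
        limW[unfolded tendsto_in_prob_def, rule_format, of "d / 3"] d(1)
      by (intro tendsto_add_zero) auto
    show "\<forall>\<^sub>F n in sequentially. prob {\<omega> \<in> space M. \<epsilon> < \<bar>V n \<omega> / W n \<omega> - a / b\<bar>}
      \<le> prob {\<omega> \<in> space M. d / 3 < \<bar>V n \<omega> - a\<bar>} + prob {\<omega> \<in> space M. d / 3 < \<bar>W n \<omega> - b\<bar>}"
    proof (intro always_eventually allI)
      fix n
      have "prob {\<omega> \<in> space M. \<epsilon> < \<bar>V n \<omega> / W n \<omega> - a / b\<bar>}
        \<le> prob ({\<omega> \<in> space M. d / 3 < \<bar>V n \<omega> - a\<bar>} \<union> {\<omega> \<in> space M. d / 3 < \<bar>W n \<omega> - b\<bar>})"
      proof (rule finite_measure_mono)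
        show "{\<omega> \<in> space M. \<epsilon> < \<bar>V n \<omega> / W n \<omega> - a / b\<bar>}
          \<subseteq> {\<omega> \<in> space M. d / 3 < \<bar>V n \<omega> - a\<bar>} \<union> {\<omega> \<in> space M. d / 3 < \<bar>W n \<omega> - b\<bar>}"
          using near by (auto simp: not_less) (meson less_le_not_le order_less_imp_le linorder_not_less)
      qed measurable
      also have "\<dots> \<le> prob {\<omega> \<in> space M. d / 3 < \<bar>V n \<omega> - a\<bar>} + prob {\<omega> \<in> space M. d / 3 < \<bar>W n \<omega> - b\<bar>}"
        by (rule measure_Un_le) measurable
      finally show "prob {\<omega> \<in> space M. \<epsilon> < \<bar>V n \<omega> / W n \<omega> - a / b\<bar>}
      \<le> prob {\<omega> \<in> space M. d / 3 < \<bar>V n \<omega> - a\<bar>} + prob {\<omega> \<in> space M. d / 3 < \<bar>W n \<omega> - b\<bar>}" .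
    qed
  qed auto
qed

end

section \<open>Factorisation over separated blocks\<close>

lemma level_field_mono:
  assumes "a' \<le> a" "b \<le> b'"
  shows "level_field M X u a b \<subseteq> level_field M X u a' b'"
  unfolding level_field_def by (rule sigma_sets_mono') (use assms in force)

text \<open>
  The fields generated by the level events, as measure spaces, so that the measurability rules
  apply to them.
\<close>

definition level_algebra :: "'a measure \<Rightarrow> (nat \<Rightarrow> 'a \<Rightarrow> real) \<Rightarrow> real \<Rightarrow> int \<Rightarrow> int \<Rightarrow> 'a measure" where
  "level_algebra M X u a b =
     sigma (space M) {{\<omega> \<in> space M. X i \<omega> \<le> u} | i. 1 \<le> i \<and> a \<le> int i \<and> int i \<le> b}"

lemma space_level_algebra [simp]: "space (level_algebra M X u a b) = space M"
  unfolding level_algebra_def by (rule space_measure_of) auto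

lemma sets_level_algebra: "sets (level_algebra M X u a b) = level_field M X u a b"
  unfolding level_algebra_def level_field_def by (rule sets_measure_of) auto

lemma upcross_level_measurable:
  assumes "1 \<le> i" "a \<le> int i" "int i + 1 \<le> b"
  shows "Measurable.pred (level_algebra M X u a b) (upcross X u i)"
proof -
  have *: "Measurable.pred (level_algebra M X u a b) (\<lambda>\<omega>. X j \<omega> \<le> u)" if "j \<in> {i, i + 1}" for j
    unfolding pred_def sets_level_algebra level_field_def space_level_algebra
    by (rule sigma_sets.Basic) (use that assms in auto)
  have [measurable]: "Measurable.pred (level_algebra M X u a b) (\<lambda>\<omega>. X i \<omega> \<le> u)"
    "Measurable.pred (level_algebra M X u a b) (\<lambda>\<omega>. X (i+1) \<omega> \<le> u)" using * by auto
  have "upcross X u i = (\<lambda>\<omega>. X i \<omega> \<le> u \<and> \<not> X (i+1) \<omega> \<le> u)"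
    by (auto simp: upcross_def fun_eq_iff)
  then show ?thesis by (simp only:) measurable
qed

text \<open>
  A mark that vanishes for runs longer than \<open>C\<close>, and for runs without end, is determined by
  the variables with indices from \<open>i\<close> to \<open>i + 2 * C + 3\<close>.
\<close>

lemma mark_level_measurable:
  assumes f: "\<And>y. y \<notin> {1..C} \<Longrightarrow> f y = 0"
    and i: "1 \<le> i" "a \<le> int i" "int i + 2 * int C + 3 \<le> b"
  shows "mark X u f i \<in> borel_measurable (level_algebra M X u a b)"
proof -
  have up: "Measurable.pred (level_algebra M X u a b) (upcross X u (i + m))" if "m \<le> 2 * C + 2" for m
    by (rule upcross_level_measurable) (use i that in auto)
  define E where "E y \<omega> \<longleftrightarrow> \<not> upcross X u (i + 0) \<omega> \<and>
      (\<forall>j\<in>{1..y}. upcross X u (i + 2 * j) \<omega>) \<and> \<not> upcross X u (i + (2 * y + 2)) \<omega>" for y \<omega>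
  have E: "E y \<omega> \<longleftrightarrow> starts_run X u i \<omega> \<and> y = run_length X u i \<omega>" if "1 \<le> y" for y \<omega>
  proof -
    have "upcross X u (i + 2) \<omega>" if "\<forall>j\<in>{1..y}. upcross X u (i + 2 * j) \<omega>"
      using bspec[OF that, of 1] \<open>1 \<le> y\<close> by simp
    then show ?thesis
      using run_length_eq_iff[OF that, of X u i \<omega>]
      unfolding E_def run_length_is_iff starts_run_def add.assoc add_0_right by metis
  qed
  have eq: "mark X u f i \<omega> = (\<Sum>y=1..C. f y * of_bool (E y \<omega>))" for \<omega>
  proof -
    have "(\<Sum>y=1..C. f y * of_bool (E y \<omega>))
      = (\<Sum>y\<in>{1..C}. if y = run_length X u i \<omega> then f y * of_bool (starts_run X u i \<omega>) else 0)"
      by (intro sum.cong refl) (auto simp: E)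
    also have "\<dots> = mark X u f i \<omega>" using f by (auto simp: mark_def)
    finally show ?thesis by simp
  qed
  have "(\<lambda>\<omega>. of_bool (E y \<omega>) :: real) \<in> borel_measurable (level_algebra M X u a b)" if "y \<in> {1..C}" for y
  proof -
    have [measurable]: "Measurable.pred (level_algebra M X u a b) (upcross X u (i + 0))"
      "Measurable.pred (level_algebra M X u a b) (upcross X u (i + (2 * y + 2)))"
      "j \<in> {1..y} \<Longrightarrow> Measurable.pred (level_algebra M X u a b) (upcross X u (i + 2 * j))" for j
      by (rule up; use that in simp)+
    show ?thesis unfolding E_def by measurable
  qed
  then show ?thesis unfolding eq[abs_def] by measurable
qed

context stationary_sequence begin

lemma level_field_events: "level_field M X u a b \<subseteq> events"
  unfolding level_field_def by (intro sets.sigma_sets_subset subsetI) auto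

lemma level_measurable_imp_measurable:
  "f \<in> borel_measurable (level_algebra M X u a b) \<Longrightarrow> f \<in> borel_measurable M"
  by (rule measurable_from_subalg) 
     (auto simp: subalgebra_def sets_level_algebra level_field_events[THEN subsetD])

lemma mixing_coeff_bdd: "bdd_above (insert 0
     {\<bar>prob (A \<inter> B) - prob A * prob B\<bar> | A B k.
        1 \<le> k \<and> k \<le> int n - l \<and>
        A \<in> level_field M X u 1 k \<and> B \<in> level_field M X u (k + l) (int n)})"
proof (rule bdd_aboveI[of _ 1])
  have "\<bar>prob (A \<inter> B) - prob A * prob B\<bar> \<le> 1" for A B
  proof -
    have "0 \<le> prob A * prob B" "prob A * prob B \<le> 1" by (auto intro: mult_le_one)
    moreover have "0 \<le> prob (A \<inter> B)" "prob (A \<inter> B) \<le> 1" by auto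
    ultimately show ?thesis by linarith
  qed
  then show "x \<in> insert 0 {\<bar>prob (A \<inter> B) - prob A * prob B\<bar> | A B k.
        1 \<le> k \<and> k \<le> int n - l \<and>
        A \<in> level_field M X u 1 k \<and> B \<in> level_field M X u (k + l) (int n)} \<Longrightarrow> x \<le> 1" for x by auto
qed

lemma mixing_coeff_nonneg: "0 \<le> mixing_coeff M X u n l"
  unfolding mixing_coeff_def by (rule cSup_upper[OF _ mixing_coeff_bdd]) simp

text \<open>
  The coefficient refers to ranges at distance exactly \<open>l\<close>; it covers larger distances because
  the second field shrinks.
\<close>

lemma mixing_coeff_ge:
  assumes "A \<in> level_field M X u 1 (int a)" "B \<in> level_field M X u (int b) (int n)"
    and "1 \<le> a" "int a + l \<le> int b" "b \<le> n"
  shows "\<bar>prob (A \<inter> B) - prob A * prob B\<bar> \<le> mixing_coeff M X u n l"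
  unfolding mixing_coeff_def
proof (rule cSup_upper[OF _ mixing_coeff_bdd], rule insertI2, rule CollectI, intro exI conjI)
  show "B \<in> level_field M X u (int a + l) (int n)"
    using assms(2) level_field_mono[of "int a + l" "int b"] assms(4) by blast
qed (use assms in auto)

lemma level_covariance_le:
  assumes f: "f \<in> borel_measurable (level_algebra M X u 1 (int a))"
    and g: "g \<in> borel_measurable (level_algebra M X u (int b) (int n))"
    and ab: "1 \<le> a" "int a + l \<le> int b" "b \<le> n"
    and f01: "\<And>\<omega>. 0 \<le> f \<omega> \<and> f \<omega> \<le> 1" and g01: "\<And>\<omega>. 0 \<le> g \<omega> \<and> g \<omega> \<le> 1"
  shows "\<bar>expectation (\<lambda>\<omega>. f \<omega> * g \<omega>) - expectation f * expectation g\<bar> \<le> mixing_coeff M X u n l"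
proof (rule covariance_le[OF _ _ f01 g01])
  fix s t :: real
  have "{\<omega> \<in> space M. s \<le> f \<omega>} \<in> level_field M X u 1 (int a)"
    using borel_measurable_le[OF borel_measurable_const f, of s] by (simp add: sets_level_algebra)
  moreover have "{\<omega> \<in> space M. t \<le> g \<omega>} \<in> level_field M X u (int b) (int n)"
    using borel_measurable_le[OF borel_measurable_const g, of t] by (simp add: sets_level_algebra)
  ultimately show "\<bar>prob ({\<omega> \<in> space M. s \<le> f \<omega>} \<inter> {\<omega> \<in> space M. t \<le> g \<omega>})
      - prob {\<omega> \<in> space M. s \<le> f \<omega>} * prob {\<omega> \<in> space M. t \<le> g \<omega>}\<bar> \<le> mixing_coeff M X u n l"
    by (rule mixing_coeff_ge[OF _ _ ab])
qed (use f g level_measurable_imp_measurable in auto)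

definition block_sum :: "real \<Rightarrow> (nat \<Rightarrow> real) \<Rightarrow> nat \<Rightarrow> nat \<Rightarrow> 'a \<Rightarrow> real" where
  "block_sum u f m h \<omega> = (\<Sum>i=1..m. mark X u f (i + h) \<omega>)"

lemma block_sum_measurable: "block_sum u f m h \<in> borel_measurable M"
  unfolding block_sum_def[abs_def] by (intro borel_measurable_sum mark_measurable) auto

lemma mark_nonneg: "(\<And>y. 0 \<le> f y) \<Longrightarrow> 0 \<le> mark X u f i \<omega>"
  by (simp add: mark_def)

text \<open>
  Splitting off the last block costs one covariance, so the total error is at most \<open>k\<close> times
  the mixing coefficient. The marks in the block starting at \<open>j * r + 1\<close> are determined by the
  indices up to \<open>j * r + m + 2 * C + 3\<close>, and the hypotheses on \<open>m\<close>, \<open>C\<close> and \<open>r\<close> keep this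
  range away from the next block.
\<close>

lemma laplace_factorisation:
  assumes f: "\<And>y. y \<notin> {1..C} \<Longrightarrow> f y = 0" "\<And>y. 0 \<le> f y" and \<theta>: "0 \<le> \<theta>"
    and sep: "m + 2 * C + 3 \<le> r" "int (m + 2 * C + 2) + l \<le> int r" and n: "k * r \<le> n"
  shows "\<bar>expectation (\<lambda>\<omega>. exp (- (\<theta> * (\<Sum>j<k. block_sum u f m (j * r) \<omega>))))
           - expectation (\<lambda>\<omega>. exp (- (\<theta> * block_sum u f m 0 \<omega>))) ^ k\<bar>
         \<le> real k * mixing_coeff M X u n l"
  using n
proof (induction k)
  case 0
  then show ?case by (simp add: prob_space)
next
  case (Suc k)
  let ?\<alpha> = "mixing_coeff M X u n l"
  define q where "q = expectation (\<lambda>\<omega>. exp (- (\<theta> * block_sum u f m 0 \<omega>)))"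
  define F where "F \<omega> = exp (- (\<theta> * (\<Sum>j<k. block_sum u f m (j * r) \<omega>)))" for \<omega>
  define G where "G \<omega> = exp (- (\<theta> * block_sum u f m (k * r) \<omega>))" for \<omega>
  have bnn: "0 \<le> block_sum u f m h \<omega>" for h \<omega>
    unfolding block_sum_def using f by (intro sum_nonneg mark_nonneg) auto
  have F01: "0 \<le> F \<omega> \<and> F \<omega> \<le> 1" and G01: "0 \<le> G \<omega> \<and> G \<omega> \<le> 1" for \<omega>
    using \<theta> bnn by (auto simp: F_def G_def intro!: mult_nonneg_nonneg sum_nonneg)
  have qG: "expectation G = q"
    using integral_marks_shift[of "{1..m}" "\<lambda>x. exp (- (\<theta> * x))" u f "k * r"]
    by (simp add: q_def G_def[abs_def] block_sum_def)
  have [measurable]: "G \<in> borel_measurable M"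
    unfolding G_def[abs_def] using block_sum_measurable by measurable
  have "integrable M G" by (rule integrable_const_bound[where B = 1]) (use G01 in auto)
  then have q01: "0 \<le> q" "q \<le> 1"
    using G01 integral_le_const[of G 1] unfolding qG[symmetric] by auto
  have "\<bar>expectation (\<lambda>\<omega>. F \<omega> * G \<omega>) - expectation F * expectation G\<bar> \<le> ?\<alpha>"
  proof (cases "k = 0")
    case True
    then have "F = (\<lambda>_. 1)" by (simp add: F_def fun_eq_iff)
    then show ?thesis by (simp add: prob_space mixing_coeff_nonneg)
  next
    case False
    \<comment> \<open>The last index that the first \<open>k\<close> blocks depend on.\<close>
    define a where "a = (k - 1) * r + m + 2 * C + 3"
    have kr: "k * r = (k - 1) * r + r" using False by (cases k) auto
    have le: "i + j * r + 2 * C + 3 \<le> a" if "j < k" "i \<le> m" for i j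
    proof -
      have "j * r \<le> (k - 1) * r" using that by (intro mult_right_mono) auto
      with that(2) show ?thesis unfolding a_def by linarith
    qed
    show ?thesis
    proof (rule level_covariance_le)
      have "mark X u f (i + j * r) \<in> borel_measurable (level_algebra M X u 1 (int a))"
        if "j < k" "i \<in> {1..m}" for i j
      proof (rule mark_level_measurable[OF f(1)])
        show "1 \<le> i + j * r" using that by auto
        then show "1 \<le> int (i + j * r)" by linarith
        show "int (i + j * r) + 2 * int C + 3 \<le> int a" 
          using le[of j i, THEN of_nat_mono[where 'a = int]] that by simp
      qed
      then have [measurable]: "j < k \<Longrightarrow> block_sum u f m (j * r) \<in> borel_measurable (level_algebra M X u 1 (int a))" for j
        unfolding block_sum_def[abs_def] by (intro borel_measurable_sum) auto
      show "F \<in> borel_measurable (level_algebra M X u 1 (int a))"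
        unfolding F_def[abs_def] by measurable
      have "mark X u f (i + k * r) \<in> borel_measurable (level_algebra M X u (int (k * r + 1)) (int n))"
        if "i \<in> {1..m}" for i
      proof (rule mark_level_measurable[OF f(1)])
        have "i + k * r + 2 * C + 3 \<le> n" using that sep(1) Suc.prems by auto
        from of_nat_mono[where 'a = int, OF this]
        show "int (i + k * r) + 2 * int C + 3 \<le> int n" by simp
      qed (use that in auto)
      then have [measurable]: "block_sum u f m (k * r) \<in> borel_measurable (level_algebra M X u (int (k * r + 1)) (int n))"
        unfolding block_sum_def[abs_def] by (intro borel_measurable_sum) auto
      show "G \<in> borel_measurable (level_algebra M X u (int (k * r + 1)) (int n))"
        unfolding G_def[abs_def] by measurable
      show "int a + l \<le> int (k * r + 1)" using sep(2) kr by (simp add: a_def)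
      show "k * r + 1 \<le> n" "1 \<le> a" using Suc.prems sep(1) by (auto simp: a_def)
    qed (use F01 G01 in auto)
  qed
  moreover have "\<bar>expectation F - q ^ k\<bar> \<le> real k * ?\<alpha>"
    using Suc by (simp add: F_def[abs_def] q_def)
  then have "\<bar>expectation F - q ^ k\<bar> * q \<le> real k * ?\<alpha> * 1"
    using q01 by (intro mult_mono) (auto simp: mixing_coeff_nonneg)
  then have "\<bar>expectation F * q - q ^ Suc k\<bar> \<le> real k * ?\<alpha>"
    using q01 abs_mult[of "expectation F - q ^ k" q] by (simp add: right_diff_distrib mult.commute)
  moreover have "expectation (\<lambda>\<omega>. exp (- (\<theta> * (\<Sum>j<Suc k. block_sum u f m (j * r) \<omega>)))) = expectation (\<lambda>\<omega>. F \<omega> * G \<omega>)"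
    by (simp add: F_def G_def algebra_simps flip: exp_add)
  ultimately show ?case unfolding q_def[symmetric] qG by (simp add: algebra_simps)
qed

end

section \<open>The Laplace transform of one block\<close>

definition run_count :: "(nat \<Rightarrow> 'a \<Rightarrow> real) \<Rightarrow> real \<Rightarrow> nat \<Rightarrow> 'a \<Rightarrow> nat" where
  "run_count X u r \<omega> = (\<Sum>i=1..r. of_bool (starts_run X u i \<omega>))"

text \<open>
  If several runs start, the left-hand side is not positive. Otherwise at most one summand is
  nonzero, so that the square of the sum is the sum of the squares, and
  \<open>x - x\<^sup>2 / 2 \<le> 1 - exp (- x)\<close> applies.
\<close>

lemma exp_sum_marks_lower:
  assumes f: "\<And>y. 0 \<le> f y" and "m \<le> r" "0 \<le> \<theta>"
  shows "\<theta> * (\<Sum>i=1..m. mark X u f i \<omega>)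
           - \<theta> * (\<Sum>i=1..m. mark X u f i \<omega> * of_bool (1 < run_count X u r \<omega>))
           - \<theta>\<^sup>2 / 2 * (\<Sum>i=1..m. mark X u (\<lambda>y. (f y)\<^sup>2) i \<omega>)
         \<le> 1 - exp (- (\<theta> * (\<Sum>i=1..m. mark X u f i \<omega>)))"
proof (cases "1 < run_count X u r \<omega>")
  case True
  have "0 \<le> \<theta>\<^sup>2 / 2 * (\<Sum>i=1..m. mark X u (\<lambda>y. (f y)\<^sup>2) i \<omega>)"
    by (intro mult_nonneg_nonneg sum_nonneg) (auto simp: mark_def)
  moreover have pos: "0 \<le> \<theta> * (\<Sum>i=1..m. mark X u f i \<omega>)"
    using assms by (intro mult_nonneg_nonneg sum_nonneg) (auto simp: mark_def)
  moreover from pos have "0 \<le> 1 - exp (- (\<theta> * (\<Sum>i=1..m. mark X u f i \<omega>)))" by simp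
  moreover have all: "(\<Sum>i=1..m. mark X u f i \<omega> * of_bool (1 < run_count X u r \<omega>)) = (\<Sum>i=1..m. mark X u f i \<omega>)"
    using True by simp
  ultimately show ?thesis unfolding all by linarith
next
  case False
  define I where "I = {i \<in> {1..m}. starts_run X u i \<omega>}"
  have "card I \<le> card {i \<in> {1..r}. starts_run X u i \<omega>}"
    unfolding I_def using \<open>m \<le> r\<close> by (intro card_mono) auto
  also have "\<dots> = run_count X u r \<omega>" by (simp add: run_count_def Int_def)
  finally have "card I \<le> 1" using False by simp
  have sum_I: "(\<Sum>i=1..m. mark X u h i \<omega>) = (\<Sum>i\<in>I. mark X u h i \<omega>)" for h
    by (rule sum.mono_neutral_right) (auto simp: I_def mark_def)
  have sq: "(\<Sum>i=1..m. mark X u (\<lambda>y. (f y)\<^sup>2) i \<omega>) = (\<Sum>i=1..m. mark X u f i \<omega>)\<^sup>2"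
  proof (cases "I = {}")
    case False
    have "finite I" by (simp add: I_def)
    then have "\<forall>x\<in>I. \<forall>y\<in>I. x = y" using card_le_Suc0_iff_eq[of I] \<open>card I \<le> 1\<close> by simp
    with False obtain i where "I = {i}" by blast
    then have one: "(\<Sum>i\<in>I. mark X u h i \<omega>) = mark X u h i \<omega>" for h by simp
    show ?thesis unfolding sum_I one by (simp add: mark_def)
  next
    case True
    then show ?thesis unfolding sum_I by simp
  qed
  have "0 \<le> \<theta> * (\<Sum>i=1..m. mark X u f i \<omega>)"
    using assms by (intro mult_nonneg_nonneg sum_nonneg) (auto simp: mark_def)
  from exp_neg_le_quadratic[OF this] show ?thesis
    using False unfolding sq by (simp add: power_mult_distrib)
qed

text \<open>
  The shortened blocks are disjoint parts of the full index range.
\<close>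

lemma sum_block_le:
  fixes f g :: "nat \<Rightarrow> real" and m r k L :: nat
  assumes gf: "\<And>i. f i \<le> g i" and g: "\<And>i. 0 \<le> g i"
    and "m \<le> r" and L: "\<And>j. j < k \<Longrightarrow> j * r + m \<le> L"
  shows "(\<Sum>j<k. \<Sum>i=1..m. f (i + j * r)) \<le> (\<Sum>i=1..L. g i)"
proof -
  have inj: "inj_on (\<lambda>(j, i). i + j * r) ({..<k} \<times> {1..m})"
  proof (rule inj_onI, clarify)
    fix j i j' i' :: nat assume a: "i \<in> {1..m}" "i' \<in> {1..m}" "i + j * r = i' + j' * r"
    have "\<not> j < j'" if "i \<in> {1..m}" "i' \<in> {1..m}" "i + j * r = i' + j' * r" for i i' j j' :: nat
    proof
      assume "j < j'"
      then have "Suc j * r \<le> j' * r" by (intro mult_right_mono) auto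
      then show False using that \<open>m \<le> r\<close> by auto
    qed
    from this[OF a] this[OF a(2,1) a(3)[symmetric]] have "j = j'" by simp
    then show "j = j' \<and> i = i'" using a by simp
  qed
  have "(\<Sum>j<k. \<Sum>i=1..m. f (i + j * r)) \<le> (\<Sum>j<k. \<Sum>i=1..m. g (i + j * r))"
    by (intro sum_mono gf)
  also have "\<dots> = (\<Sum>(j, i)\<in>{..<k} \<times> {1..m}. g (i + j * r))"
    by (simp add: sum.cartesian_product)
  also have "\<dots> = sum g ((\<lambda>(j, i). i + j * r) ` ({..<k} \<times> {1..m}))"
    by (subst sum.reindex[OF inj]) (simp add: o_def case_prod_unfold)
  also have "\<dots> \<le> sum g {1..L}"
    by (rule sum_mono2) (use L g in \<open>auto intro: order.trans[OF add_le_mono]\<close>, force)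
  finally show ?thesis .
qed

context stationary_sequence begin

lemma mark_integrable_of_le:
  assumes int: "integrable M (mark X u real 1)" and f: "\<And>y. \<bar>f y\<bar> \<le> K * max 1 (real y)" and i: "1 \<le> i"
  shows "integrable M (mark X u f i)"
proof (rule Bochner_Integration.integrable_bound)
  note [measurable] = mark_measurable[OF i]
  show "integrable M (\<lambda>\<omega>. K * (1 + mark X u real i \<omega>))"
    using integrable_mark[OF int i] by simp
  show "AE \<omega> in M. norm (mark X u f i \<omega>) \<le> norm (K * (1 + mark X u real i \<omega>))"
  proof (intro AE_I2)
    fix \<omega>
    have K: "0 \<le> K" using f[of 0] by simp
    let ?y = "run_length X u i \<omega>"
    have "K * max 1 (real ?y) \<le> K * (1 + real ?y)" using K by (intro mult_left_mono) auto
    then have "\<bar>f ?y\<bar> \<le> K * (1 + real ?y)" using f[of ?y] by linarith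
    then show "norm (mark X u f i \<omega>) \<le> norm (K * (1 + mark X u real i \<omega>))"
      using K by (cases "starts_run X u i \<omega>") (auto simp: mark_def abs_mult)
  qed
qed (use mark_measurable[OF i] in measurable)

lemma run_count_measurable: "run_count X u r \<in> measurable M (count_space UNIV)"
proof -
  have [measurable]: "i \<in> {1..r} \<Longrightarrow> Measurable.pred M (starts_run X u i)" for i
    using starts_run_measurable by auto
  show ?thesis unfolding run_count_def[abs_def] by measurable
qed

lemma integrable_mult_of_bool:
  fixes f :: "'a \<Rightarrow> real"
  assumes "integrable M f" "Measurable.pred M P"
  shows "integrable M (\<lambda>\<omega>. f \<omega> * of_bool (P \<omega>))"
proof (rule Bochner_Integration.integrable_bound[OF assms(1)])
  note assms(2)[measurable] borel_measurable_integrable[OF assms(1), measurable]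
  show "(\<lambda>\<omega>. f \<omega> * of_bool (P \<omega>)) \<in> borel_measurable M" by measurable
qed auto

lemma several_runs_measurable: "Measurable.pred M (\<lambda>\<omega>. 1 < run_count X u r \<omega>)"
  using run_count_measurable[of u r] by measurable

text \<open>
  To first order, \<open>1 - q\<close> is \<open>\<theta>\<close> times the mean of the block sum; \<open>B\<close> controls the
  contribution of several runs in one block, and \<open>\<sigma>\<close> the second order term.
\<close>

lemma block_laplace_bounds:
  assumes f: "\<And>y. 0 \<le> f y" "\<And>y. f y \<le> real y" and bdd: "\<And>y. f y \<le> K"
    and "m \<le> r" "0 \<le> \<theta>"
    and int: "integrable M (mark X u real 1)"
    and B: "\<And>i. i \<in> {1..m} \<Longrightarrow> expectation (\<lambda>\<omega>. mark X u real i \<omega> * of_bool (1 < run_count X u r \<omega>)) \<le> B"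
  defines "\<mu> \<equiv> expectation (mark X u f 1)"
    and "\<sigma> \<equiv> expectation (mark X u (\<lambda>y. (f y)\<^sup>2) 1)"
    and "q \<equiv> expectation (\<lambda>\<omega>. exp (- (\<theta> * block_sum u f m 0 \<omega>)))"
  shows "1 - q \<le> \<theta> * (real m * \<mu>)"
    and "\<theta> * (real m * \<mu>) - \<theta> * (real m * B) - \<theta>\<^sup>2 / 2 * (real m * \<sigma>) \<le> 1 - q"
proof -
  have fi: "integrable M (mark X u f i)" if "i \<in> {1..m}" for i
    using that f by (intro mark_integrable_of_le[OF int, of _ 1]) (auto simp: le_max_iff_disj)
  have f2i: "integrable M (mark X u (\<lambda>y. (f y)\<^sup>2) i)" if "i \<in> {1..m}" for i
  proof (intro mark_integrable_of_le[OF int, of _ "K\<^sup>2"])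
    fix y
    have "(f y)\<^sup>2 \<le> K\<^sup>2 * 1" using f bdd by (simp add: power_mono)
    also have "\<dots> \<le> K\<^sup>2 * max 1 (real y)" by (intro mult_left_mono) auto
    finally show "\<bar>(f y)\<^sup>2\<bar> \<le> K\<^sup>2 * max 1 (real y)" by simp
  qed (use that in auto)
  have bsum: "block_sum u f m 0 \<omega> = (\<Sum>i=1..m. mark X u f i \<omega>)" for \<omega> by (simp add: block_sum_def)
  define h where "h i \<omega> = mark X u f i \<omega> * of_bool (1 < run_count X u r \<omega>)" for i \<omega>
  have hi: "integrable M (h i)" if "i \<in> {1..m}" for i
    unfolding h_def[abs_def] by (rule integrable_mult_of_bool[OF fi[OF that] several_runs_measurable])
  have sums: "integrable M (\<lambda>\<omega>. \<Sum>i=1..m. mark X u f i \<omega>)"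
    "integrable M (\<lambda>\<omega>. \<Sum>i=1..m. mark X u (\<lambda>y. (f y)\<^sup>2) i \<omega>)"
    "integrable M (\<lambda>\<omega>. \<Sum>i=1..m. h i \<omega>)"
    by (intro Bochner_Integration.integrable_sum fi f2i hi; assumption)+
  have esums: "expectation (\<lambda>\<omega>. \<Sum>i=1..m. mark X u f i \<omega>) = real m * \<mu>"
    "expectation (\<lambda>\<omega>. \<Sum>i=1..m. mark X u (\<lambda>y. (f y)\<^sup>2) i \<omega>) = real m * \<sigma>"
    "expectation (\<lambda>\<omega>. \<Sum>i=1..m. h i \<omega>) = (\<Sum>i=1..m. expectation (h i))"
  proof -
    show "expectation (\<lambda>\<omega>. \<Sum>i=1..m. h i \<omega>) = (\<Sum>i=1..m. expectation (h i))"
      by (rule Bochner_Integration.integral_sum[OF hi])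
    have "expectation (\<lambda>\<omega>. \<Sum>i=1..m. mark X u f i \<omega>) = (\<Sum>i=1..m. expectation (mark X u f i))"
      by (rule Bochner_Integration.integral_sum[OF fi])
    also have "\<dots> = (\<Sum>i=1..m. \<mu>)" unfolding \<mu>_def by (intro sum.cong refl integral_mark) auto
    finally show "expectation (\<lambda>\<omega>. \<Sum>i=1..m. mark X u f i \<omega>) = real m * \<mu>" by simp
    have "expectation (\<lambda>\<omega>. \<Sum>i=1..m. mark X u (\<lambda>y. (f y)\<^sup>2) i \<omega>) = (\<Sum>i=1..m. expectation (mark X u (\<lambda>y. (f y)\<^sup>2) i))"
      by (rule Bochner_Integration.integral_sum[OF f2i])
    also have "\<dots> = (\<Sum>i=1..m. \<sigma>)" unfolding \<sigma>_def by (intro sum.cong refl integral_mark) auto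
    finally show "expectation (\<lambda>\<omega>. \<Sum>i=1..m. mark X u (\<lambda>y. (f y)\<^sup>2) i \<omega>) = real m * \<sigma>" by simp
  qed
  have bi: "integrable M (block_sum u f m 0)" unfolding bsum[abs_def] by (rule sums)
  have eb: "expectation (block_sum u f m 0) = real m * \<mu>"
    unfolding bsum[abs_def] by (rule esums)
  have bnn: "0 \<le> block_sum u f m 0 \<omega>" for \<omega>
    unfolding bsum using f by (intro sum_nonneg mark_nonneg) auto
  have ei: "integrable M (\<lambda>\<omega>. exp (- (\<theta> * block_sum u f m 0 \<omega>)))"
    using block_sum_measurable bnn \<open>0 \<le> \<theta>\<close> by (intro integrable_const_bound[where B = 1]) auto
  have q1: "1 - q = expectation (\<lambda>\<omega>. 1 - exp (- (\<theta> * block_sum u f m 0 \<omega>)))"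
    unfolding q_def using ei by (simp add: prob_space)
  have "expectation (\<lambda>\<omega>. 1 - exp (- (\<theta> * block_sum u f m 0 \<omega>))) \<le> expectation (\<lambda>\<omega>. \<theta> * block_sum u f m 0 \<omega>)"
  proof (intro integral_mono)
    show "1 - exp (- (\<theta> * block_sum u f m 0 \<omega>)) \<le> \<theta> * block_sum u f m 0 \<omega>" for \<omega>
      using exp_ge_add_one_self[of "- (\<theta> * block_sum u f m 0 \<omega>)"] by simp
  qed (use ei bi in auto)
  then show "1 - q \<le> \<theta> * (real m * \<mu>)" using q1 eb by simp
  have eh: "expectation (h i) \<le> B" if i: "i \<in> {1..m}" for i
  proof -
    have "expectation (h i) \<le> expectation (\<lambda>\<omega>. mark X u real i \<omega> * of_bool (1 < run_count X u r \<omega>))"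
      unfolding h_def[abs_def] using f hi[OF i, unfolded h_def[abs_def]] integrable_mult_of_bool[OF integrable_mark[OF int] several_runs_measurable, of i u r] i
      by (intro integral_mono mult_right_mono) (auto simp: mark_def mult_right_mono)
    then show ?thesis using B[OF i] by simp
  qed
  have "\<theta> * (real m * \<mu>) - \<theta> * (real m * B) - \<theta>\<^sup>2 / 2 * (real m * \<sigma>)
    \<le> \<theta> * (real m * \<mu>) - \<theta> * (\<Sum>i=1..m. expectation (h i)) - \<theta>\<^sup>2 / 2 * (real m * \<sigma>)"
    using sum_bounded_above[of "{1..m}" "\<lambda>i. expectation (h i)" B, OF eh] \<open>0 \<le> \<theta>\<close>
    by (simp add: mult_left_mono)
  also have "\<dots> = expectation (\<lambda>\<omega>. \<theta> * (\<Sum>i=1..m. mark X u f i \<omega>) - \<theta> * (\<Sum>i=1..m. h i \<omega>)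
           - \<theta>\<^sup>2 / 2 * (\<Sum>i=1..m. mark X u (\<lambda>y. (f y)\<^sup>2) i \<omega>))"
    using sums by (simp add: esums del: One_nat_def)
  also have "\<dots> \<le> expectation (\<lambda>\<omega>. 1 - exp (- (\<theta> * block_sum u f m 0 \<omega>)))"
  proof (intro integral_mono)
    show "\<theta> * (\<Sum>i=1..m. mark X u f i \<omega>) - \<theta> * (\<Sum>i=1..m. h i \<omega>)
           - \<theta>\<^sup>2 / 2 * (\<Sum>i=1..m. mark X u (\<lambda>y. (f y)\<^sup>2) i \<omega>)
      \<le> 1 - exp (- (\<theta> * block_sum u f m 0 \<omega>))" for \<omega>
      unfolding bsum h_def by (rule exp_sum_marks_lower[OF f(1) \<open>m \<le> r\<close> \<open>0 \<le> \<theta>\<close>])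
  qed (use sums ei in auto)
  finally show "\<theta> * (real m * \<mu>) - \<theta> * (real m * B) - \<theta>\<^sup>2 / 2 * (real m * \<sigma>) \<le> 1 - q"
    using q1 by simp
qed

text \<open>
  Since the difference is nonnegative, its expectation is its distance in mean.
\<close>

lemma expectation_sum_minus_blocks:
  assumes f: "\<And>y. 0 \<le> f y" "\<And>y. f y \<le> g y" "\<And>y. g y \<le> max 1 (real y)"
    and int: "integrable M (mark X u real 1)"
    and "m \<le> r" and L: "\<And>j. j < k \<Longrightarrow> j * r + m \<le> L"
  defines "D \<equiv> \<lambda>\<omega>. (\<Sum>i=1..L. mark X u g i \<omega>) - (\<Sum>j<k. block_sum u f m (j * r) \<omega>)"
  shows "integrable M D" "0 \<le> D \<omega>"
    "expectation D = real L * expectation (mark X u g 1) - real k * real m * expectation (mark X u f 1)"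
proof -
  have i: "integrable M (mark X u g i)" "integrable M (mark X u f i)" if "1 \<le> i" for i
    using f that order.trans[OF f(1,2)] order.trans[OF f(2,3)]
    by (auto intro!: mark_integrable_of_le[OF int, of _ 1])
  have sums: "integrable M (\<lambda>\<omega>. \<Sum>i=1..L. mark X u g i \<omega>)"
    "integrable M (block_sum u f m h)" for h
    unfolding block_sum_def[abs_def] by (intro Bochner_Integration.integrable_sum i; simp)+
  show "integrable M D" unfolding D_def
    by (intro Bochner_Integration.integrable_diff Bochner_Integration.integrable_sum sums)
  show "0 \<le> D \<omega>" unfolding D_def block_sum_def
    using sum_block_le[of "\<lambda>i. mark X u f i \<omega>" "\<lambda>i. mark X u g i \<omega>", OF _ _ \<open>m \<le> r\<close> L] 
      f(2) order.trans[OF f(1,2)] by (auto simp: mark_def)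
  have "expectation (block_sum u f m h) = real m * expectation (mark X u f 1)" for h
  proof -
    have "expectation (block_sum u f m h) = (\<Sum>i=1..m. expectation (mark X u f (i + h)))"
      unfolding block_sum_def[abs_def] by (intro Bochner_Integration.integral_sum i) simp
    also have "\<dots> = (\<Sum>i=1..m. expectation (mark X u f 1))" by (intro sum.cong refl integral_mark) auto
    finally show ?thesis by simp
  qed
  moreover have "expectation (\<lambda>\<omega>. \<Sum>i=1..L. mark X u g i \<omega>) = real L * expectation (mark X u g 1)"
  proof -
    have "expectation (\<lambda>\<omega>. \<Sum>i=1..L. mark X u g i \<omega>) = (\<Sum>i=1..L. expectation (mark X u g i))"
      by (intro Bochner_Integration.integral_sum i) simp
    also have "\<dots> = (\<Sum>i=1..L. expectation (mark X u g 1))" by (intro sum.cong refl integral_mark) auto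
    finally show ?thesis by simp
  qed
  moreover have "expectation D = expectation (\<lambda>\<omega>. \<Sum>i=1..L. mark X u g i \<omega>) - (\<Sum>j<k. expectation (block_sum u f m (j * r)))"
    unfolding D_def using sums by simp
  ultimately show "expectation D = real L * expectation (mark X u g 1) - real k * real m * expectation (mark X u f 1)"
    by simp
qed

end

section \<open>The weak law for sums over runs\<close>

text \<open>
  The value \<open>0\<close> is cut off as well: there a run start begins a run without end, which is not
  determined by finitely many variables.
\<close>

definition truncated :: "(nat \<Rightarrow> real) \<Rightarrow> nat \<Rightarrow> nat \<Rightarrow> real" where
  "truncated g C y = (if y \<in> {1..C} then g y else 0)"

context stationary_sequence begin

lemma prob_up_block_mult: "prob (up_block u 1 (b * h)) \<le> real b * prob (up_block u 1 h)"
proof (induction b)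
  case 0
  then show ?case by (simp add: up_block_def)
next
  case (Suc b)
  have "up_block u 1 (Suc b * h) \<subseteq> up_block u 1 (b * h) \<union> up_block u (1 + b * h) h"
  proof
    fix \<omega> assume "\<omega> \<in> up_block u 1 (Suc b * h)"
    then obtain j where j: "\<omega> \<in> space M" "j \<in> {1..<1 + Suc b * h}" "upcross X u j \<omega>"
      by (auto simp: up_block_def)
    then show "\<omega> \<in> up_block u 1 (b * h) \<union> up_block u (1 + b * h) h"
      by (cases "j < 1 + b * h") (auto simp: up_block_def)
  qed
  then have "prob (up_block u 1 (Suc b * h)) \<le> prob (up_block u 1 (b * h) \<union> up_block u (1 + b * h) h)"
    by (rule finite_measure_mono) (auto intro!: sets.Un sets_up_block)
  also have "\<dots> \<le> prob (up_block u 1 (b * h)) + prob (up_block u (1 + b * h) h)"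
    by (rule measure_Un_le) (auto intro!: sets_up_block)
  also have "prob (up_block u (1 + b * h) h) = prob (up_block u 1 h)" by (rule prob_up_block) simp
  finally show ?case using Suc by (simp add: algebra_simps)
qed

text \<open>
  If a run starts among the first \<open>r\<close> indices, there is an upcrossing among the first \<open>r + 2\<close>.
  The probability of the former is at least the mean number of starts minus its contribution
  from the event of several starts; the latter range is covered by \<open>(r + 2) / h + 1\<close> windows
  of length \<open>h\<close>.
\<close>

lemma up_block_lower_bound:
  assumes lim: "(\<lambda>j. prob (all_up u 0 j)) \<longlonglongrightarrow> 0"
    and B: "\<And>i. i \<in> {1..r} \<Longrightarrow> expectation (\<lambda>\<omega>. mark X u real i \<omega> * of_bool (1 < run_count X u r \<omega>)) \<le> B"
    and "0 < h"
  shows "real r * (expectation (mark X u (\<lambda>_. 1) 1) - B)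
           \<le> (real (r + 2) / real h + 1) * prob (up_block u 1 h)"
proof -
  have int: "integrable M (mark X u real 1)"
    using run_mean[OF lim] by (simp add: has_bochner_integral_iff)
  define s where "s i = mark X u (\<lambda>_. 1) i" for i
  define t where "t i \<omega> = s i \<omega> * of_bool (1 < run_count X u r \<omega>)" for i \<omega>
  have si: "integrable M (s i)" if "i \<in> {1..r}" for i
    unfolding s_def using that by (intro mark_integrable_of_le[OF int, of _ 1]) auto
  have ti: "integrable M (t i)" if "i \<in> {1..r}" for i
    unfolding t_def[abs_def] by (rule integrable_mult_of_bool[OF si[OF that] several_runs_measurable])
  have es: "expectation (s i) = expectation (mark X u (\<lambda>_. 1) 1)" if "i \<in> {1..r}" for i
    unfolding s_def using that by (intro integral_mark) auto
  have et: "expectation (t i) \<le> B" if i: "i \<in> {1..r}" for i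
  proof -
    have i1: "1 \<le> i" using i by simp
    have "expectation (t i) \<le> expectation (\<lambda>\<omega>. mark X u real i \<omega> * of_bool (1 < run_count X u r \<omega>))"
    proof (rule integral_mono_AE[OF ti[OF i]])
      show "integrable M (\<lambda>\<omega>. mark X u real i \<omega> * of_bool (1 < run_count X u r \<omega>))"
        by (rule integrable_mult_of_bool[OF integrable_mark[OF int i1] several_runs_measurable])
      show "AE \<omega> in M. t i \<omega> \<le> mark X u real i \<omega> * of_bool (1 < run_count X u r \<omega>)"
        using runs_almost_surely_finite[OF lim i1]
        by eventually_elim (auto simp: t_def s_def mark_def)
    qed
    then show ?thesis using B[OF i] by simp
  qed
  have "real r * (expectation (mark X u (\<lambda>_. 1) 1) - B) \<le> (\<Sum>i=1..r. expectation (s i) - expectation (t i))"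
    using sum_mono[of "{1..r}" "\<lambda>i. expectation (mark X u (\<lambda>_. 1) 1) - B" "\<lambda>i. expectation (s i) - expectation (t i)"]
      es et by simp
  also have "\<dots> = expectation (\<lambda>\<omega>. \<Sum>i=1..r. s i \<omega> - t i \<omega>)"
  proof -
    have "expectation (\<lambda>\<omega>. \<Sum>i=1..r. s i \<omega> - t i \<omega>) = (\<Sum>i=1..r. expectation (\<lambda>\<omega>. s i \<omega> - t i \<omega>))"
      by (intro Bochner_Integration.integral_sum Bochner_Integration.integrable_diff si ti)
    also have "\<dots> = (\<Sum>i=1..r. expectation (s i) - expectation (t i))"
      by (intro sum.cong refl Bochner_Integration.integral_diff si ti)
    finally show ?thesis by simp
  qed
  also have "\<dots> \<le> expectation (indicator (up_block u 1 (r + 2)))"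
  proof (rule integral_mono)
    show "integrable M (\<lambda>\<omega>. \<Sum>i=1..r. s i \<omega> - t i \<omega>)"
      by (intro Bochner_Integration.integrable_sum Bochner_Integration.integrable_diff si ti)
    show "integrable M (indicator (up_block u 1 (r + 2)) :: 'a \<Rightarrow> real)"
      using sets_up_block[of 1 u "r + 2"] by (auto simp: less_top[symmetric])
    fix \<omega> assume \<omega>: "\<omega> \<in> space M"
    have c: "(\<Sum>i=1..r. s i \<omega>) = real (run_count X u r \<omega>)"
      by (simp add: s_def mark_def run_count_def)
    show "(\<Sum>i=1..r. s i \<omega> - t i \<omega>) \<le> indicator (up_block u 1 (r + 2)) \<omega>"
    proof (cases "1 < run_count X u r \<omega>")
      case True
      then show ?thesis by (simp add: t_def)
    next
      case False
      then have "(\<Sum>i=1..r. s i \<omega> - t i \<omega>) = real (run_count X u r \<omega>)"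
        using c by (simp add: t_def)
      moreover have "\<omega> \<in> up_block u 1 (r + 2)" if "run_count X u r \<omega> \<noteq> 0"
      proof -
        from that obtain i where "i \<in> {1..r}" "starts_run X u i \<omega>"
          unfolding run_count_def by (metis (mono_tags, lifting) of_bool_eq(1) sum.neutral)
        then show ?thesis using \<omega> by (auto simp: up_block_def starts_run_def intro!: bexI[of _ "i + 2"])
      qed
      ultimately show ?thesis using False by (cases "run_count X u r \<omega> = 0") (auto simp: indicator_def)
    qed
  qed
  also have "\<dots> = prob (up_block u 1 (r + 2))"
    using sets_up_block[of 1 u "r + 2"] sets.sets_into_space[OF sets_up_block[of 1 u "r + 2"]]
    by (simp add: Int_absorb2)
  also have "\<dots> \<le> prob (up_block u 1 (((r + 2) div h + 1) * h))"
  proof (rule finite_measure_mono)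
    have "r + 2 \<le> ((r + 2) div h + 1) * h"
      using dividend_less_div_times[OF \<open>0 < h\<close>, of "r + 2"] by (simp add: algebra_simps)
    then show "up_block u 1 (r + 2) \<subseteq> up_block u 1 (((r + 2) div h + 1) * h)"
      unfolding up_block_def by fastforce
  qed (auto intro: sets_up_block)
  also have "\<dots> \<le> real ((r + 2) div h + 1) * prob (up_block u 1 h)"
    by (rule prob_up_block_mult)
  also have "\<dots> \<le> (real (r + 2) / real h + 1) * prob (up_block u 1 h)"
  proof (rule mult_right_mono)
    have "real ((r + 2) div h) * real h \<le> real (r + 2)"
      by (metis div_times_less_eq_dividend of_nat_le_iff of_nat_mult)
    then show "real ((r + 2) div h + 1) \<le> real (r + 2) / real h + 1"
      using \<open>0 < h\<close> by (simp add: field_simps)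
  qed simp
  finally show ?thesis .
qed

text \<open>
  The sum is compared in mean with the sum \<open>S\<close> of the truncated marks over the \<open>k n\<close> shortened
  blocks. The Laplace transform of \<open>S\<close> at \<open>s\<close> is close to \<open>q ^ k n\<close>, where \<open>k n * (1 - q)\<close>
  tends to \<open>s * \<gamma>\<close>.
\<close>

lemma mark_sum_weak_law:
  fixes c :: "nat \<Rightarrow> real" and l :: "nat \<Rightarrow> int" and B :: "nat \<Rightarrow> real"
  assumes int: "\<forall>\<^sub>F n in sequentially. integrable M (mark X (v n) real 1)"
    and c: "\<forall>\<^sub>F n in sequentially. 0 < c n"
    and k: "filterlim k at_top sequentially"
    and sep: "\<forall>\<^sub>F n in sequentially. m n + 2 * C n + 3 \<le> r n \<and>
        int (m n + 2 * C n + 2) + l n \<le> int (r n) \<and> k n * r n \<le> n"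
    and full: "(\<lambda>n. real (k n) * real (m n) / real n) \<longlonglongrightarrow> 1"
    and mix: "(\<lambda>n. real (k n) * mixing_coeff M X (v n) n (l n)) \<longlonglongrightarrow> 0"
    and g: "\<And>y. 0 \<le> g y" "\<And>y. g y \<le> max 1 (real y)"
    and mean: "(\<lambda>n. real n / c n * expectation (mark X (v n) g 1)) \<longlonglongrightarrow> \<gamma>"
    and tail: "(\<lambda>n. real n / c n * expectation (mark X (v n) (\<lambda>y. g y - truncated g (C n) y) 1)) \<longlonglongrightarrow> 0"
    and mult: "\<forall>\<^sub>F n in sequentially. \<forall>i\<in>{1..r n}.
        expectation (\<lambda>\<omega>. mark X (v n) real i \<omega> * of_bool (1 < run_count X (v n) (r n) \<omega>)) \<le> B n"
    and B: "(\<lambda>n. real n / c n * B n) \<longlonglongrightarrow> 0"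
    and second: "(\<lambda>n. real n / (c n)\<^sup>2 * expectation (mark X (v n) (\<lambda>y. (truncated g (C n) y)\<^sup>2) 1)) \<longlonglongrightarrow> 0"
  shows "tendsto_in_prob M (\<lambda>n \<omega>. (\<Sum>i=1..n - 3. mark X (v n) g i \<omega>) / c n) \<gamma>"
proof -
  define f where "f n = truncated g (C n)" for n
  have f: "0 \<le> f n y" "f n y \<le> real y" "f n y \<le> g y" "f n y \<le> real (C n)" "y \<notin> {1..C n} \<Longrightarrow> f n y = 0" for n y
    using g(1)[of y] g(2)[of y] by (auto simp: f_def truncated_def max_def split: if_splits)
  define \<mu> where "\<mu> n = expectation (mark X (v n) (f n) 1)" for n
  define \<sigma> where "\<sigma> n = expectation (mark X (v n) (\<lambda>y. (f n y)\<^sup>2) 1)" for n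
  have \<mu>_lim: "(\<lambda>n. real n / c n * \<mu> n) \<longlonglongrightarrow> \<gamma>"
  proof (rule Lim_transform_eventually)
    show "(\<lambda>n. real n / c n * expectation (mark X (v n) g 1)
      - real n / c n * expectation (mark X (v n) (\<lambda>y. g y - truncated g (C n) y) 1)) \<longlonglongrightarrow> \<gamma>"
      using tendsto_diff[OF mean tail] by simp
    show "\<forall>\<^sub>F n in sequentially. real n / c n * expectation (mark X (v n) g 1)
      - real n / c n * expectation (mark X (v n) (\<lambda>y. g y - truncated g (C n) y) 1) = real n / c n * \<mu> n"
      using int
    proof eventually_elim
      case (elim n)
      have "integrable M (mark X (v n) g 1)" "integrable M (mark X (v n) (f n) 1)"
        using g f(1-3) order.trans[OF f(3) g(2)] by (auto intro!: mark_integrable_of_le[OF elim, of _ 1])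
      moreover have "mark X (v n) (\<lambda>y. g y - truncated g (C n) y) 1 = (\<lambda>\<omega>. mark X (v n) g 1 \<omega> - mark X (v n) (f n) 1 \<omega>)"
        by (simp add: fun_eq_iff mark_def f_def left_diff_distrib)
      ultimately show ?case by (simp add: \<mu>_def right_diff_distrib)
    qed
  qed
  \<comment> \<open>The absolute value makes \<open>S n\<close> nonnegative also for the finitely many \<open>n\<close> with \<open>c n \<le> 0\<close>.\<close>
  define S where "S n \<omega> = (\<Sum>j<k n. block_sum (v n) (f n) (m n) (j * r n) \<omega>) / \<bar>c n\<bar>" for n \<omega>
  have bnn: "0 \<le> block_sum (v n) (f n) (m n) h \<omega>" for n h \<omega>
    unfolding block_sum_def using f by (intro sum_nonneg mark_nonneg) auto
  have S: "S n \<in> borel_measurable M" for n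
    unfolding S_def[abs_def] using block_sum_measurable by measurable
  have S_lim: "tendsto_in_prob M S \<gamma>"
  proof (rule tendsto_in_prob_of_laplace[OF S])
    show "0 \<le> S n \<omega>" for n \<omega> unfolding S_def using bnn by (intro divide_nonneg_nonneg sum_nonneg) auto
    fix s :: real assume "s \<in> {1, 2}"
    then have s: "0 \<le> s" by auto
    define q where "q n = expectation (\<lambda>\<omega>. exp (- (s / c n * block_sum (v n) (f n) (m n) 0 \<omega>)))" for n
    have "(\<lambda>n. real (k n) * (1 - q n)) \<longlonglongrightarrow> s * \<gamma>"
    proof -
      \<comment> \<open>The two bounds of \<open>block_laplace_bounds\<close> for \<open>\<theta> = s / c n\<close>, multiplied by \<open>k n\<close>.\<close>
      define up where "up n = s * (real (k n) * real (m n) / real n * (real n / c n * \<mu> n))" for n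
      define lo where "lo n = up n - s * (real (k n) * real (m n) / real n * (real n / c n * B n))
         - s\<^sup>2 / 2 * (real (k n) * real (m n) / real n * (real n / (c n)\<^sup>2 * \<sigma> n))" for n
      have up: "up \<longlonglongrightarrow> s * \<gamma>"
        unfolding up_def using tendsto_mult[OF tendsto_const tendsto_mult[OF full \<mu>_lim]] by simp
      have "lo \<longlonglongrightarrow> s * \<gamma> - s * (1 * 0) - s\<^sup>2 / 2 * (1 * 0)"
        unfolding lo_def \<sigma>_def f_def by (intro tendsto_intros up full B second)
      then have lo: "lo \<longlonglongrightarrow> s * \<gamma>" by simp
      have both: "\<forall>\<^sub>F n in sequentially. lo n \<le> real (k n) * (1 - q n) \<and> real (k n) * (1 - q n) \<le> up n"
        using int c sep mult eventually_gt_at_top[of 0]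
      proof eventually_elim
        case (elim n)
        have mr: "m n \<le> r n" using elim by simp
        have \<theta>: "0 \<le> s / c n" using elim s by simp
        note bd = block_laplace_bounds[where u = "v n" and f = "f n" and K = "real (C n)" and B = "B n",
            OF f(1) f(2) f(4) mr \<theta> elim(1), folded \<mu>_def \<sigma>_def q_def]
        have Bi: "expectation (\<lambda>\<omega>. mark X (v n) real i \<omega> * of_bool (1 < run_count X (v n) (r n) \<omega>)) \<le> B n"
          if "i \<in> {1..m n}" for i using elim mr that by auto
        have "real (k n) * (1 - q n) \<le> real (k n) * (s / c n * (real (m n) * \<mu> n))"
          by (intro mult_left_mono bd(1) Bi) auto
        also have "\<dots> = up n" using elim by (simp add: up_def)
        finally have u: "real (k n) * (1 - q n) \<le> up n" .
        have "lo n = real (k n) * (s / c n * (real (m n) * \<mu> n) - s / c n * (real (m n) * B n) - (s / c n)\<^sup>2 / 2 * (real (m n) * \<sigma> n))"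
          using elim by (simp add: lo_def up_def field_simps power2_eq_square)
        also have "\<dots> \<le> real (k n) * (1 - q n)"
          by (intro mult_left_mono bd(2) Bi) auto
        finally show ?case using u by simp
      qed
      show ?thesis
        by (rule tendsto_sandwich[OF _ _ lo up]) (use both in \<open>auto elim: eventually_mono\<close>)
    qed
    then have q: "(\<lambda>n. q n ^ k n) \<longlonglongrightarrow> exp (- (s * \<gamma>))" by (rule power_tendsto_exp[OF k])
    have "(\<lambda>n. expectation (\<lambda>\<omega>. exp (- (s * S n \<omega>))) - q n ^ k n) \<longlonglongrightarrow> 0"
    proof (rule Lim_null_comparison[OF _ mix])
      show "\<forall>\<^sub>F n in sequentially. norm (expectation (\<lambda>\<omega>. exp (- (s * S n \<omega>))) - q n ^ k n)
        \<le> real (k n) * mixing_coeff M X (v n) n (l n)"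
        using c sep
      proof eventually_elim
        case (elim n)
        have \<theta>: "0 \<le> s / c n" using elim s by simp
        show ?case
          using laplace_factorisation[where u = "v n" and f = "f n" and C = "C n" and m = "m n"
              and r = "r n" and l = "l n" and k = "k n" and n = n, OF f(5) f(1) \<theta>] elim
          by (simp add: S_def q_def)
      qed
    qed
    from tendsto_add[OF this q] show "(\<lambda>n. expectation (\<lambda>\<omega>. exp (- (s * S n \<omega>)))) \<longlonglongrightarrow> exp (- (s * \<gamma>))" by simp
  qed
  define W where "W n \<omega> = (\<Sum>i=1..n - 3. mark X (v n) g i \<omega>) / c n" for n \<omega>
  define d where "d n = real (n - 3) / real n * (real n / c n * expectation (mark X (v n) g 1))
     - real (k n) * real (m n) / real n * (real n / c n * \<mu> n)" for n
  have "tendsto_in_prob M W \<gamma>"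
  proof (rule tendsto_in_prob_of_L1[OF _ S S_lim])
    show "W n \<in> borel_measurable M" for n
    proof -
      have [measurable]: "i \<in> {1..n - 3} \<Longrightarrow> mark X (v n) g i \<in> borel_measurable M" for i
        by (rule mark_measurable) auto
      show ?thesis unfolding W_def[abs_def] by measurable
    qed
    show "\<forall>\<^sub>F n in sequentially. integrable M (\<lambda>\<omega>. W n \<omega> - S n \<omega>) \<and> expectation (\<lambda>\<omega>. \<bar>W n \<omega> - S n \<omega>\<bar>) \<le> d n"
      using int c sep eventually_gt_at_top[of 0]
    proof eventually_elim
      case (elim n)
      have L: "j * r n + m n \<le> n - 3" if "j < k n" for j
      proof -
        have "Suc j * r n \<le> k n * r n" using that by (intro mult_right_mono) auto
        moreover have "k n * r n \<le> n" "m n + 3 \<le> r n" using elim by auto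
        ultimately show ?thesis by simp
      qed
      have mr: "m n \<le> r n" using elim by simp
      define D where "D \<omega> = (\<Sum>i=1..n - 3. mark X (v n) g i \<omega>) - (\<Sum>j<k n. block_sum (v n) (f n) (m n) (j * r n) \<omega>)" for \<omega>
      note D = expectation_sum_minus_blocks[where f = "f n" and g = g, OF f(1) f(3) g(2) elim(1) mr, of "k n" "n - 3", OF L, folded D_def]
      have WS: "W n \<omega> - S n \<omega> = D \<omega> / c n" for \<omega>
        using elim by (simp add: W_def S_def D_def diff_divide_distrib)
      have "expectation (\<lambda>\<omega>. \<bar>W n \<omega> - S n \<omega>\<bar>) = expectation D / c n"
        unfolding WS using D(2) elim by simp
      also have "\<dots> = d n"
        using elim by (simp add: D(3) d_def \<mu>_def field_simps)
      finally show ?case unfolding WS using D(1) by simp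
    qed
    have "(\<lambda>n. real (n - 3) / real n) \<longlonglongrightarrow> 1"
    proof (rule Lim_transform_eventually)
      show "(\<lambda>n. 1 - 3 * (1 / real n)) \<longlonglongrightarrow> 1"
        using tendsto_diff[OF tendsto_const tendsto_mult[OF tendsto_const lim_1_over_n], of 1 3] by simp
      show "\<forall>\<^sub>F n in sequentially. 1 - 3 * (1 / real n) = real (n - 3) / real n"
        using eventually_ge_at_top[of 3] by eventually_elim (simp add: field_simps)
    qed
    then have "d \<longlonglongrightarrow> 1 * \<gamma> - 1 * \<gamma>"
      unfolding d_def by (intro tendsto_intros full mean \<mu>_lim)
    then show "d \<longlonglongrightarrow> 0" by simp
  qed
  then show ?thesis by (simp add: W_def[abs_def])
qed

end

section \<open>The law of a run length and the mixing coefficients\<close>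

context stationary_sequence begin

lemma mark_one_eq: "\<omega> \<in> space M \<Longrightarrow> mark X u (\<lambda>_. 1) i \<omega> = indicator (run_start M X u i) \<omega>"
  by (simp add: mark_def indicator_def run_start_iff)

lemma run_start_event: "1 \<le> i \<Longrightarrow> run_start M X u i \<in> events"
proof -
  assume "1 \<le> i"
  then have [measurable]: "Measurable.pred M (starts_run X u i)" by (rule starts_run_measurable)
  have "run_start M X u i = {\<omega> \<in> space M. starts_run X u i \<omega>}" by (auto simp: run_start_iff)
  then show ?thesis by simp
qed

lemma prob_run_start: "1 \<le> i \<Longrightarrow> prob (run_start M X u i) = expectation (mark X u (\<lambda>_. 1) 1)"
proof -
  assume i: "1 \<le> i"
  have "expectation (mark X u (\<lambda>_. 1) 1) = expectation (mark X u (\<lambda>_. 1) i)"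
    by (rule integral_mark[OF i, symmetric])
  also have "\<dots> = expectation (indicator (run_start M X u i))"
    by (rule Bochner_Integration.integral_cong) (auto simp: mark_one_eq)
  also have "\<dots> = prob (run_start M X u i)"
    using run_start_event[OF i] sets.sets_into_space[OF run_start_event[OF i]] by (simp add: Int_absorb2)
  finally show ?thesis by simp
qed

lemma nn_integral_run_start:
  assumes i: "1 \<le> i" and P: "Measurable.pred M P" and F: "\<And>y. 0 \<le> F y"
    and int: "integrable M (mark X u F i)" and a: "0 < expectation (mark X u (\<lambda>_. 1) 1)"
  shows "(\<integral>\<^sup>+\<omega>. ennreal (F (run_length X u i \<omega>)) * indicator {\<omega> \<in> space M. P \<omega>} \<omega> \<partial>uniform_measure M (run_start M X u i))
    = ennreal (expectation (\<lambda>\<omega>. mark X u F i \<omega> * of_bool (P \<omega>)) / expectation (mark X u (\<lambda>_. 1) 1))"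
proof -
  note [measurable] = run_length_measurable[OF i] P run_start_event[OF i]
  have "(\<integral>\<^sup>+\<omega>. ennreal (F (run_length X u i \<omega>)) * indicator {\<omega> \<in> space M. P \<omega>} \<omega> \<partial>uniform_measure M (run_start M X u i))
    = (\<integral>\<^sup>+\<omega>. ennreal (F (run_length X u i \<omega>)) * indicator {\<omega> \<in> space M. P \<omega>} \<omega> * indicator (run_start M X u i) \<omega> \<partial>M)
      / emeasure M (run_start M X u i)"
    by (rule nn_integral_uniform_measure) measurable
  also have "(\<integral>\<^sup>+\<omega>. ennreal (F (run_length X u i \<omega>)) * indicator {\<omega> \<in> space M. P \<omega>} \<omega> * indicator (run_start M X u i) \<omega> \<partial>M)
    = (\<integral>\<^sup>+\<omega>. ennreal (mark X u F i \<omega> * of_bool (P \<omega>)) \<partial>M)"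
    by (rule nn_integral_cong) (auto simp: mark_def indicator_def run_start_iff)
  also have "\<dots> = ennreal (expectation (\<lambda>\<omega>. mark X u F i \<omega> * of_bool (P \<omega>)))"
    by (rule nn_integral_eq_integral[OF integrable_mult_of_bool[OF int P]]) (auto simp: mark_def F)
  also have "emeasure M (run_start M X u i) = ennreal (expectation (mark X u (\<lambda>_. 1) 1))"
    by (simp add: emeasure_eq_measure prob_run_start[OF i])
  finally show ?thesis using a
    by (simp add: divide_ennreal integral_nonneg_AE mark_def F)
qed

lemma nn_integral_Z_dist:
  assumes F: "\<And>y. 0 \<le> F y" and int: "integrable M (mark X u F 1)"
    and a: "0 < expectation (mark X u (\<lambda>_. 1) 1)"
  shows "(\<integral>\<^sup>+z. ennreal (F z) \<partial>Z_dist M X u 1)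
    = ennreal (expectation (mark X u F 1) / expectation (mark X u (\<lambda>_. 1) 1))"
proof -
  have "run_length X u 1 \<in> measurable (uniform_measure M (run_start M X u 1)) (count_space UNIV)"
    using run_length_measurable[of 1 u] by simp
  then have "(\<integral>\<^sup>+z. ennreal (F z) \<partial>Z_dist M X u 1)
    = (\<integral>\<^sup>+\<omega>. ennreal (F (run_length X u 1 \<omega>)) \<partial>uniform_measure M (run_start M X u 1))"
    unfolding Z_dist_def by (rule nn_integral_distr) simp
  also have "\<dots> = (\<integral>\<^sup>+\<omega>. ennreal (F (run_length X u 1 \<omega>)) * indicator {\<omega> \<in> space M. True} \<omega> \<partial>uniform_measure M (run_start M X u 1))"
    by (rule nn_integral_cong) (simp add: indicator_def)
  also have "\<dots> = ennreal (expectation (\<lambda>\<omega>. mark X u F 1 \<omega> * of_bool True) / expectation (mark X u (\<lambda>_. 1) 1))"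
    by (rule nn_integral_run_start[OF order_refl _ F int a]) simp
  finally show ?thesis by simp
qed

lemma Z_expect_on_eq:
  assumes j: "1 \<le> j" and P: "Measurable.pred M P"
    and int: "integrable M (mark X u real 1)" and a: "0 < expectation (mark X u (\<lambda>_. 1) 1)"
  shows "Z_expect_on M X u j {\<omega> \<in> space M. P \<omega>}
    = ennreal (expectation (\<lambda>\<omega>. mark X u real j \<omega> * of_bool (P \<omega>)) / expectation (mark X u (\<lambda>_. 1) 1))"
  unfolding Z_expect_on_def
  using nn_integral_run_start[OF j P, of real u, OF _ integrable_mark[OF int j] a]
  by (simp add: ennreal_of_nat_eq_real_of_nat)

lemma Z_dist_null:
  assumes "expectation (mark X u (\<lambda>_. 1) 1) = 0"
  shows "(\<integral>\<^sup>+z. of_nat z \<partial>Z_dist M X u 1) = 0"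
proof -
  have m: "run_length X u 1 \<in> measurable (uniform_measure M (run_start M X u 1)) (count_space UNIV)"
    using run_length_measurable[of 1 u] by simp
  have e: "run_start M X u 1 \<in> null_sets M"
    using prob_run_start[of 1 u] assms run_start_event[of 1 u] by (simp add: null_sets_def emeasure_eq_measure)
  have "(\<integral>\<^sup>+z. of_nat z \<partial>Z_dist M X u 1)
    = (\<integral>\<^sup>+\<omega>. of_nat (run_length X u 1 \<omega>) \<partial>uniform_measure M (run_start M X u 1))"
    unfolding Z_dist_def by (rule nn_integral_distr[OF m]) simp
  also have "\<dots> = (\<integral>\<^sup>+\<omega>. of_nat (run_length X u 1 \<omega>) * indicator (run_start M X u 1) \<omega> \<partial>M) / emeasure M (run_start M X u 1)"
    by (rule nn_integral_uniform_measure) (use run_length_measurable[of 1 u] run_start_event[of 1 u] in measurable)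
  also have "(\<integral>\<^sup>+\<omega>. of_nat (run_length X u 1 \<omega>) * indicator (run_start M X u 1) \<omega> \<partial>M) = 0"
    by (rule nn_integral_null_set[OF e])
  finally show ?thesis by simp
qed

text \<open>
  At a lag of at most \<open>0\<close> the index ranges overlap, so the coefficient bounds \<open>p * (1 - p)\<close>
  with \<open>p\<close> the probability that \<open>X 1 \<le> u\<close>; an upcrossing has probability at most the minimum
  of \<open>p\<close> and \<open>1 - p\<close>.
\<close>

lemma prob_upcross_le_mixing:
  assumes "1 \<le> n" "l \<le> 0"
  shows "prob {\<omega> \<in> space M. upcross X u 1 \<omega>} \<le> 2 * mixing_coeff M X u n l"
proof -
  define A where "A i = {\<omega> \<in> space M. X i \<omega> \<le> u}" for i
  have ev: "A i \<in> events" if "1 \<le> i" for i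
    unfolding A_def using X_measurable[OF that] by measurable
  have eq: "prob (A 2) = prob (A 1)"
  proof -
    have "Measurable.pred (PiM {1..} (\<lambda>_. borel)) (\<lambda>x. x (1::nat) \<le> u)"
      using coordinate_measurable[of 1] by measurable
    from prob_event_shift[OF this, of "\<lambda>h \<omega>. X (1 + h) \<omega> \<le> u" 1]
    show ?thesis by (simp add: A_def numeral_2_eq_2)
  qed
  define p where "p = prob (A 1)"
  have "A 1 \<in> level_field M X u 1 1"
    unfolding level_field_def A_def by (rule sigma_sets.Basic) auto
  then have "A 1 \<in> level_field M X u 1 (int 1)" "A 1 \<in> level_field M X u (int 1) (int n)"
    using level_field_mono[of 1 1 1 "int n" M X u] assms by auto
  from mixing_coeff_ge[OF this order_refl, of l] assms
  have mix: "\<bar>p - p * p\<bar> \<le> mixing_coeff M X u n l" by (simp add: p_def)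
  have "prob {\<omega> \<in> space M. upcross X u 1 \<omega>} \<le> p"
    unfolding p_def by (rule finite_measure_mono[OF _ ev]) (auto simp: A_def upcross_def)
  moreover have "prob {\<omega> \<in> space M. upcross X u 1 \<omega>} \<le> prob (space M - A 2)"
    by (rule finite_measure_mono) (use ev[of 2] in \<open>auto simp: A_def upcross_def numeral_2_eq_2\<close>)
  then have "prob {\<omega> \<in> space M. upcross X u 1 \<omega>} \<le> 1 - p"
    using prob_compl[OF ev[of 2]] eq by (simp add: p_def)
  moreover have two: "p \<le> 2 * (p - p * p) \<or> 1 - p \<le> 2 * (p - p * p)"
  proof (cases "p \<le> 1 / 2")
    case True
    then have "p * p \<le> p * (1 / 2)" by (intro mult_left_mono) (auto simp: p_def)
    then show ?thesis by simp
  next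
    case False
    have "2 * (p - p * p) - (1 - p) = (1 - p) * (2 * p - 1)" by (simp add: algebra_simps)
    moreover have "0 \<le> (1 - p) * (2 * p - 1)"
      using False by (intro mult_nonneg_nonneg) (auto simp: p_def)
    ultimately have "1 - p \<le> 2 * (p - p * p)" by linarith
    then show ?thesis ..
  qed
  moreover have "p - p * p \<le> mixing_coeff M X u n l" using mix by (rule abs_le_D1)
  then have "2 * (p - p * p) \<le> 2 * mixing_coeff M X u n l" by (rule mult_left_mono) simp
  ultimately show ?thesis by (meson order.trans)
qed

text \<open>
  For positive \<open>l\<close> the event on the left is the event of the upcrossing process on the right,
  which ends at \<open>n - 1\<close>. For \<open>l \<le> 0\<close> that event is empty, but then \<open>h\<close> is \<open>1\<close> and the mixing
  coefficient alone bounds the probability of an upcrossing.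
\<close>

lemma up_block_le_mixing:
  assumes n: "2 \<le> n" and h: "h = nat (max 1 (min l (int n - 1)))"
  shows "prob (up_block u 1 h) \<le> 2 * (mixing_coeff M X u n (l - 2) +
      prob {\<omega> \<in> space M. 0 < upcross_process X u n {0..real_of_int l / real n} \<omega>})"
proof (cases "1 \<le> l")
  case True
  have eq: "{\<omega> \<in> space M. 0 < upcross_process X u n {0..real_of_int l / real n} \<omega>} = up_block u 1 h"
  proof -
    have "0 < upcross_process X u n {0..real_of_int l / real n} \<omega> \<longleftrightarrow> (\<exists>j\<in>{1..<1+h}. upcross X u j \<omega>)" for \<omega>
    proof -
      have "0 < upcross_process X u n {0..real_of_int l / real n} \<omega>
        \<longleftrightarrow> (\<exists>j\<in>{1..n - 1}. upcross X u j \<omega> \<and> real j / real n \<in> {0..real_of_int l / real n})"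
        unfolding upcross_process_def neq0_conv[symmetric] sum_eq_0_iff[OF finite_atLeastAtMost]
        by (auto simp: indicator_def)
      also have "\<dots> \<longleftrightarrow> (\<exists>j\<in>{1..<1+h}. upcross X u j \<omega>)"
      proof -
        have "real j / real n \<le> real_of_int l / real n \<longleftrightarrow> int j \<le> l" for j
          using n by (simp add: divide_le_cancel) (metis of_int_le_iff of_int_of_nat_eq)
        moreover have "j \<in> {1..n - 1} \<and> int j \<le> l \<longleftrightarrow> j \<in> {1..<1+h}" for j
        proof -
          have "int h = min l (int n - 1)" using n True by (simp add: h)
          then show ?thesis using n by (auto simp: min_def split: if_splits)
        qed
        ultimately show ?thesis unfolding atLeastAtMost_iff[symmetric] by (metis (no_types, lifting)
            atLeastAtMost_iff divide_nonneg_nonneg of_nat_0_le_iff)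
      qed
      finally show ?thesis .
    qed
    then show ?thesis by (simp add: up_block_def)
  qed
  show ?thesis unfolding eq
    using mixing_coeff_nonneg[of u n "l - 2"] measure_nonneg[of M "up_block u 1 h"] by (simp add: distrib_left)
next
  case False
  then have "h = 1" using n by (simp add: h)
  then have "prob (up_block u 1 h) = prob {\<omega> \<in> space M. upcross X u 1 \<omega>}" by (simp add: up_block_def)
  also have "\<dots> \<le> 2 * mixing_coeff M X u n (l - 2)"
    by (rule prob_upcross_le_mixing) (use n False in auto)
  finally show ?thesis 
    using measure_nonneg[of M "{\<omega> \<in> space M. 0 < upcross_process X u n {0..real_of_int l / real n} \<omega>}"]
    by (simp add: distrib_left add_increasing2)
qed

lemma all_up_tendsto_0:
  assumes "(\<lambda>j. prob {\<omega> \<in> space M. \<forall>i\<in>{2..j}. X (2 * i - 1) \<omega> \<le> u \<and> u < X (2 * i) \<omega>}) \<longlonglongrightarrow> 0"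
  shows "(\<lambda>j. prob (all_up u 0 j)) \<longlonglongrightarrow> 0"
proof -
  have "{\<omega> \<in> space M. \<forall>i\<in>{2..Suc j}. X (2 * i - 1) \<omega> \<le> u \<and> u < X (2 * i) \<omega>} = all_up u 1 j" for j
  proof -
    have shift: "{2..Suc j} = Suc ` {1..j}" by (simp add: numeral_2_eq_2)
    show ?thesis unfolding shift by (simp add: all_up_def upcross_def del: image_Suc_atLeastAtMost)
  qed
  with LIMSEQ_Suc[OF assms] show ?thesis using prob_all_up[of u 1] by simp
qed

lemma expectation_mark_mono:
  assumes lim: "(\<lambda>j. prob (all_up u 0 j)) \<longlonglongrightarrow> 0"
    and fg: "\<And>y. 1 \<le> y \<Longrightarrow> f y \<le> g y"
    and int: "integrable M (mark X u f 1)" "integrable M (mark X u g 1)"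
  shows "expectation (mark X u f 1) \<le> expectation (mark X u g 1)"
proof (rule integral_mono_AE[OF int])
  show "AE \<omega> in M. mark X u f 1 \<omega> \<le> mark X u g 1 \<omega>"
    using runs_almost_surely_finite[OF lim order_refl]
    by eventually_elim (auto simp: mark_def intro!: fg)
qed

end

section \<open>The blocks asymptotically\<close>

lemma tendsto_in_prob_cong:
  assumes "tendsto_in_prob M V a"
    and "\<forall>\<^sub>F n in sequentially. \<forall>\<omega>\<in>space M. V n \<omega> = W n \<omega>"
  shows "tendsto_in_prob M W a"
  unfolding tendsto_in_prob_def
proof (intro allI impI)
  fix \<epsilon> :: real assume "0 < \<epsilon>"
  then have "(\<lambda>n. measure M {\<omega> \<in> space M. \<epsilon> < \<bar>V n \<omega> - a\<bar>}) \<longlonglongrightarrow> 0"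
    using assms(1) by (simp add: tendsto_in_prob_def)
  moreover have "\<forall>\<^sub>F n in sequentially. measure M {\<omega> \<in> space M. \<epsilon> < \<bar>V n \<omega> - a\<bar>}
    = measure M {\<omega> \<in> space M. \<epsilon> < \<bar>W n \<omega> - a\<bar>}"
    using assms(2) by eventually_elim (rule arg_cong[where f = "measure M"], auto)
  ultimately show "(\<lambda>n. measure M {\<omega> \<in> space M. \<epsilon> < \<bar>W n \<omega> - a\<bar>}) \<longlonglongrightarrow> 0"
    by (rule Lim_transform_eventually)
qed

text \<open>
  The number \<open>P n\<close> stands for the probability of an upcrossing in a window of length \<open>h n\<close>.
  The inequality \<open>window\<close>, multiplied by \<open>k n\<close>, has a left-hand side of order \<open>c n\<close>; since
  \<open>k n * P n\<close> tends to \<open>0\<close>, the number \<open>r n / h n\<close> of windows in a block must be at least of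
  order \<open>c n\<close>.
\<close>

lemma block_structure:
  fixes c :: "nat \<Rightarrow> real" and k r h :: "nat \<Rightarrow> nat" and P x :: "nat \<Rightarrow> real"
  assumes c: "filterlim c at_top sequentially" and k: "filterlim k at_top sequentially"
    and r: "\<forall>\<^sub>F n in sequentially. r n = n div k n"
    and kc: "(\<lambda>n. real (k n) * c n / real n) \<longlonglongrightarrow> 0"
    and h: "\<And>n. 0 < h n"
    and kP: "(\<lambda>n. real (k n) * P n) \<longlonglongrightarrow> 0"
    and x: "(\<lambda>n. real n / c n * x n) \<longlonglongrightarrow> \<delta>" and \<delta>: "0 < \<delta>"
    and window: "\<forall>\<^sub>F n in sequentially. real (r n) * x n \<le> (real (r n + 2) / real (h n) + 1) * P n"
  shows "(\<lambda>n. real (k n) * real (r n) / real n) \<longlonglongrightarrow> 1"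
    and "(\<lambda>n. real (k n) * real (h n) / real n) \<longlonglongrightarrow> 0"
proof -
  have c_pos: "\<forall>\<^sub>F n in sequentially. K < c n" for K
    using c by (simp add: filterlim_at_top_dense)
  have ic: "(\<lambda>n. 1 / c n) \<longlonglongrightarrow> 0"
    using tendsto_inverse_0_at_top[OF c] by (simp add: inverse_eq_divide)
  have kn: "(\<lambda>n. real (k n) / real n) \<longlonglongrightarrow> 0"
  proof (rule Lim_transform_eventually)
    show "(\<lambda>n. real (k n) * c n / real n * (1 / c n)) \<longlonglongrightarrow> 0"
      using tendsto_mult[OF kc ic] by simp
    show "\<forall>\<^sub>F n in sequentially. real (k n) * c n / real n * (1 / c n) = real (k n) / real n"
      using c_pos[of 0] by eventually_elim simp
  qed
  have k_pos: "\<forall>\<^sub>F n in sequentially. 0 < k n"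
    by (rule eventually_compose_filterlim[OF eventually_gt_at_top k])
  show kr: "(\<lambda>n. real (k n) * real (r n) / real n) \<longlonglongrightarrow> 1"
  proof (rule tendsto_sandwich)
    show "\<forall>\<^sub>F n in sequentially. 1 - real (k n) / real n \<le> real (k n) * real (r n) / real n"
      using r k_pos eventually_gt_at_top[of 0]
    proof eventually_elim
      case (elim n)
      have "n < k n + (n div k n) * k n" by (rule dividend_less_div_times[OF elim(2)])
      then have "n \<le> k n + k n * r n" using elim(1) by (simp add: mult.commute)
      then have "real n \<le> real (k n) + real (k n) * real (r n)"
        by (metis of_nat_add of_nat_le_iff of_nat_mult)
      from divide_right_mono[OF this, of "real n"] show ?case
        using elim(3) by (simp add: add_divide_distrib)
    qed
    show "\<forall>\<^sub>F n in sequentially. real (k n) * real (r n) / real n \<le> 1"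
      using r eventually_gt_at_top[of 0]
    proof eventually_elim
      case (elim n)
      have "k n * r n \<le> n" using elim by simp
      then have "real (k n) * real (r n) \<le> real n" by (metis of_nat_le_iff of_nat_mult)
      then show ?case using elim by simp
    qed
    show "(\<lambda>n. 1 - real (k n) / real n) \<longlonglongrightarrow> 1" using tendsto_diff[OF tendsto_const kn, of 1] by simp
  qed simp
  have "(\<lambda>n. real (k n) * real (r n) / real n * (real n / c n * x n)) \<longlonglongrightarrow> 1 * \<delta>"
    by (intro tendsto_mult kr x)
  then have low: "\<forall>\<^sub>F n in sequentially. \<delta> / 2 < real (k n) * real (r n) / real n * (real n / c n * x n)"
    by (rule order_tendstoD) (use \<delta> in simp)
  have small: "\<forall>\<^sub>F n in sequentially. real (k n) * P n < 1" using kP by (rule order_tendstoD) simp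
  show "(\<lambda>n. real (k n) * real (h n) / real n) \<longlonglongrightarrow> 0"
  proof (rule tendsto_sandwich[of "\<lambda>_. 0"])
    show "(\<lambda>n. 4 / \<delta> * (1 / c n) * (real (k n) * real (r n) / real n + 2 * (real (k n) / real n))) \<longlonglongrightarrow> 0"
      using tendsto_mult[OF tendsto_mult[OF tendsto_const ic] tendsto_add[OF kr tendsto_mult[OF tendsto_const kn]], of "4 / \<delta>" 2] by simp
    show "\<forall>\<^sub>F n in sequentially. real (k n) * real (h n) / real n
      \<le> 4 / \<delta> * (1 / c n) * (real (k n) * real (r n) / real n + 2 * (real (k n) / real n))"
      using low small window c_pos[of "4 / \<delta>"] c_pos[of 0] eventually_gt_at_top[of 0]
    proof eventually_elim
      case (elim n)
      define y where "y = \<delta> * c n / 2"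
      have y: "2 < y" using elim(4) \<delta> by (simp add: y_def field_simps)
      have "y < real (k n) * (real (r n) * x n)"
        using elim by (simp add: y_def field_simps)
      also have "\<dots> \<le> real (k n) * ((real (r n + 2) / real (h n) + 1) * P n)"
        by (intro mult_left_mono elim(3)) simp
      also have "\<dots> = (real (r n + 2) / real (h n) + 1) * (real (k n) * P n)" by simp
      also have "\<dots> \<le> (real (r n + 2) / real (h n) + 1) * 1"
        using elim(2) by (intro mult_left_mono) auto
      finally have le: "y * real (h n) \<le> real (r n + 2) + real (h n)" using h[of n] by (simp add: field_simps)
      define z where "z = y * real (h n)"
      have "2 * real (h n) \<le> z" unfolding z_def using y by (intro mult_right_mono) auto
      moreover have "z \<le> real (r n + 2) + real (h n)" using le by (simp only: z_def)
      ultimately have "real (h n) \<le> real (r n + 2)" "z \<le> real (r n + 2) + real (h n)" by auto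
      then have "z \<le> 2 * real (r n + 2)" by auto
      then have "y * real (h n) \<le> 2 * real (r n + 2)" by (simp only: z_def)
      then have "real (k n) * (y * real (h n)) \<le> real (k n) * (2 * real (r n + 2))" by (intro mult_left_mono) auto
      then show ?case using elim(5,6) \<delta> by (simp add: y_def field_simps)
    qed
  qed auto
qed

section \<open>Consistency of the estimator\<close>

theorem corollary3p1:
  fixes M :: "'a measure"
    and X :: "nat \<Rightarrow> 'a \<Rightarrow> real"
    and u :: "real \<Rightarrow> nat \<Rightarrow> real"
    and \<eta> \<nu> :: real
    and c :: "nat \<Rightarrow> real"
    and k r :: "nat \<Rightarrow> nat"
    and v :: "nat \<Rightarrow> real"
  assumes prob: "prob_space M"
    and stat: "stationary_seq M X"
    and D3: "\<And>\<mu>. \<mu> > 0 \<Longrightarrow> D3_condition M X (u \<mu>)"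
    and long_runs: "\<And>\<mu> n. \<mu> > 0 \<Longrightarrow> n \<ge> 1 \<Longrightarrow>
          (\<lambda>j. measure M {\<omega> \<in> space M. \<forall>i\<in>{2..j}. X (2 * i - 1) \<omega> \<le> u \<mu> n \<and> u \<mu> n < X (2 * i) \<omega>})
            \<longlonglongrightarrow> 0"
    and index: "has_upcrossings_index M X u \<eta>" and eta_pos: "\<eta> > 0"
    and nu_pos: "\<nu> > 0"
    and k_pos: "\<And>n. n \<ge> 1 \<Longrightarrow> k n > 0"
    and c_lim: "filterlim c at_top sequentially"
    and k_lim: "filterlim k at_top sequentially"
    and c_k: "(\<lambda>n. c n / real (k n)) \<longlonglongrightarrow> 0"
    and r_eq: "\<And>n. n \<ge> 1 \<Longrightarrow> r n = n div k n"
    and v_eq: "\<And>n. n \<ge> 1 \<Longrightarrow> v n = u \<nu> (nat \<lfloor>real n / c n\<rfloor>)"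
    and v_lim: "(\<lambda>n. real n * measure M {\<omega> \<in> space M. upcross X (v n) 1 \<omega>} - c n * \<nu>) \<longlonglongrightarrow> 0"
    and EZ: "(\<lambda>n. \<integral>\<^sup>+z. of_nat z \<partial>Z_dist M X (v n) 1) \<longlonglongrightarrow> ennreal (1 / \<eta>)"
    and mixing: "\<exists>l :: nat \<Rightarrow> int.
          (\<lambda>n. real (k n) *
             (mixing_coeff M X (v n) n (l n - 2) +
              measure M {\<omega> \<in> space M.
                upcross_process X (v n) n {0..real_of_int (l n) / real n} \<omega> > 0})) \<longlonglongrightarrow> 0"
    and multiple: "(\<lambda>n. SUP j\<in>{1..r n}.
          Z_expect_on M X (v n) j {\<omega> \<in> space M. N_hat M X (v n) (min (r n) (n - 3)) \<omega> > 1}) \<longlonglongrightarrow> 0"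
    and tail: "(\<lambda>n. \<integral>\<^sup>+z. of_nat z * indicator {z. real z > c n} z \<partial>Z_dist M X (v n) 1) \<longlonglongrightarrow> 0"
    and trunc: "(\<lambda>n. ennreal (1 / c n) *
          (\<integral>\<^sup>+z. (of_nat z)\<^sup>2 * indicator {z. real z \<le> c n} z \<partial>Z_dist M X (v n) 1)) \<longlonglongrightarrow> 0"
  shows "tendsto_in_prob M (\<lambda>n. eta_hat M X (v n) n) \<eta>"
proof -
  interpret stationary_sequence M X
    using prob stat by (simp add: stationary_sequence_def stationary_sequence_axioms_def)
  define p where "p n = prob {\<omega> \<in> space M. upcross X (v n) 1 \<omega>}" for n
  define a where "a n = expectation (mark X (v n) (\<lambda>_. 1) 1)" for n
  from mixing obtain l :: "nat \<Rightarrow> int" where l: "(\<lambda>n. real (k n) *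
             (mixing_coeff M X (v n) n (l n - 2) +
              prob {\<omega> \<in> space M. upcross_process X (v n) n {0..real_of_int (l n) / real n} \<omega> > 0})) \<longlonglongrightarrow> 0"
    by blast
  \<comment> \<open>The lag \<open>l n\<close> restricted to the indices that the upcrossing process sees. That \<open>h n\<close> bounds \<open>l n\<close> for
    large \<open>n\<close> follows only once \<open>h n\<close> is known to be small compared with \<open>n\<close>.\<close>
  define h where "h n = nat (max 1 (min (l n) (int n - 1)))" for n
  have h_pos: "0 < h n" for n by (simp add: h_def)
  define P where "P n = prob (up_block (v n) 1 (h n))" for n
  have c_gt: "\<forall>\<^sub>F n in sequentially. K < c n" for K
    using c_lim by (simp add: filterlim_at_top_dense)
  have k_gt: "\<forall>\<^sub>F n in sequentially. K < k n" for K
    by (rule eventually_compose_filterlim[OF eventually_gt_at_top k_lim])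
  have ic: "(\<lambda>n. 1 / c n) \<longlonglongrightarrow> 0"
    using tendsto_inverse_0_at_top[OF c_lim] by (simp add: inverse_eq_divide)

  have kP: "(\<lambda>n. real (k n) * P n) \<longlonglongrightarrow> 0"
  proof (rule Lim_null_comparison)
    show "\<forall>\<^sub>F n in sequentially. norm (real (k n) * P n) \<le> 2 * (real (k n) *
             (mixing_coeff M X (v n) n (l n - 2) +
              prob {\<omega> \<in> space M. upcross_process X (v n) n {0..real_of_int (l n) / real n} \<omega> > 0}))"
      using eventually_ge_at_top[of 2]
    proof eventually_elim
      case (elim n)
      have "P n \<le> 2 * (mixing_coeff M X (v n) n (l n - 2) +
              prob {\<omega> \<in> space M. upcross_process X (v n) n {0..real_of_int (l n) / real n} \<omega> > 0})"
        unfolding P_def by (rule up_block_le_mixing[OF elim]) (simp add: h_def)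
      from mult_left_mono[OF this, of "real (k n)"] show ?case by (simp add: P_def mult.left_commute)
    qed
    show "(\<lambda>n. 2 * (real (k n) *
             (mixing_coeff M X (v n) n (l n - 2) +
              prob {\<omega> \<in> space M. upcross_process X (v n) n {0..real_of_int (l n) / real n} \<omega> > 0}))) \<longlonglongrightarrow> 0"
      using tendsto_mult[OF tendsto_const l, of 2] by simp
  qed
  have mix: "(\<lambda>n. real (k n) * mixing_coeff M X (v n) n (l n - 2)) \<longlonglongrightarrow> 0"
    by (rule Lim_null_comparison[OF always_eventually l])
       (auto intro!: mult_left_mono simp: abs_mult mixing_coeff_nonneg)
  have kp: "(\<lambda>n. real (k n) * p n) \<longlonglongrightarrow> 0"
  proof (rule Lim_null_comparison[OF always_eventually kP], rule allI)
    fix n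
    have "p n \<le> P n" unfolding p_def P_def
    proof (rule finite_measure_mono[OF _ sets_up_block])
      show "{\<omega> \<in> space M. upcross X (v n) 1 \<omega>} \<subseteq> up_block (v n) 1 (h n)"
        using h_pos[of n] by (auto simp: up_block_def)
    qed simp
    then show "norm (real (k n) * p n) \<le> real (k n) * P n"
      by (simp add: p_def mult_left_mono)
  qed
  have npc: "(\<lambda>n. real n * p n / c n) \<longlonglongrightarrow> \<nu>"
  proof (rule Lim_transform_eventually)
    show "(\<lambda>n. (real n * p n - c n * \<nu>) * (1 / c n) + \<nu>) \<longlonglongrightarrow> \<nu>"
      using tendsto_add[OF tendsto_mult[OF v_lim ic] tendsto_const[of \<nu>]] by (simp add: p_def)
    show "\<forall>\<^sub>F n in sequentially. (real n * p n - c n * \<nu>) * (1 / c n) + \<nu> = real n * p n / c n"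
      using c_gt[of 0] by eventually_elim (simp add: field_simps)
  qed
  have p_pos: "\<forall>\<^sub>F n in sequentially. 0 < p n"
    using order_tendstoD(1)[OF npc nu_pos] c_gt[of 0]
  proof eventually_elim
    case (elim n)
    then have "p n \<noteq> 0" by auto
    then show ?case by (simp add: p_def zero_less_measure_iff)
  qed
  have kc: "(\<lambda>n. real (k n) * c n / real n) \<longlonglongrightarrow> 0"
  proof (rule Lim_transform_eventually)
    show "(\<lambda>n. real (k n) * p n / (real n * p n / c n)) \<longlonglongrightarrow> 0"
      using tendsto_divide[OF kp npc] nu_pos by simp
    show "\<forall>\<^sub>F n in sequentially. real (k n) * p n / (real n * p n / c n) = real (k n) * c n / real n"
      using p_pos c_gt[of 0] eventually_gt_at_top[of 0] by eventually_elim (simp add: field_simps)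
  qed
  \<comment> \<open>Finiteness of the runs at level \<open>v n\<close> needs \<open>n / c n \<ge> 1\<close>, so that \<open>v n\<close> is one of the given levels
    with a positive index.\<close>
  have run_lim: "\<forall>\<^sub>F n in sequentially. (\<lambda>j. prob (all_up (v n) 0 j)) \<longlonglongrightarrow> 0"
    using order_tendstoD(2)[OF kc, of 1, OF zero_less_one] c_gt[of 0] k_gt[of 0] eventually_gt_at_top[of 0]
  proof eventually_elim
    case (elim n)
    have "1 * c n \<le> real (k n) * c n" using elim by (intro mult_right_mono) auto
    also have "\<dots> < real n" using elim by (simp add: field_simps)
    finally have "c n \<le> real n" by simp
    then have "1 \<le> nat \<lfloor>real n / c n\<rfloor>" using elim by (simp add: le_nat_iff le_floor_iff)
    from all_up_tendsto_0[OF long_runs[OF nu_pos this]] show ?case using v_eq[of n] elim by simp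
  qed
  have mean_real: "\<forall>\<^sub>F n in sequentially. integrable M (mark X (v n) real 1) \<and> expectation (mark X (v n) real 1) = p n"
    using run_lim by eventually_elim (use run_mean in \<open>auto simp: p_def has_bochner_integral_iff\<close>)
  then have int: "\<forall>\<^sub>F n in sequentially. integrable M (mark X (v n) real 1)"
    by eventually_elim simp

  \<comment> \<open>If no run could start, the expected run length would be \<open>0\<close>, which is away from \<open>1 / \<eta>\<close>.\<close>
  have a_pos: "\<forall>\<^sub>F n in sequentially. 0 < a n"
  proof -
    have "0 < ennreal (1 / \<eta>)" using eta_pos by simp
    from order_tendstoD(1)[OF EZ this] show ?thesis
    proof eventually_elim
      case (elim n)
      then have "a n \<noteq> 0" using Z_dist_null[of "v n"] by (auto simp: a_def)
      moreover have "0 \<le> a n" unfolding a_def prob_run_start[OF order_refl, symmetric] by simp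
      ultimately show ?case by simp
    qed
  qed
  have pa: "(\<lambda>n. p n / a n) \<longlonglongrightarrow> 1 / \<eta>"
  proof (rule tendsto_ennrealD)
    show "(\<lambda>n. ennreal (p n / a n)) \<longlonglongrightarrow> ennreal (1 / \<eta>)"
    proof (rule Lim_transform_eventually[OF EZ])
      show "\<forall>\<^sub>F n in sequentially. (\<integral>\<^sup>+z. of_nat z \<partial>Z_dist M X (v n) 1) = ennreal (p n / a n)"
        using mean_real a_pos
      proof eventually_elim
        case (elim n)
        then show ?case using nn_integral_Z_dist[of real "v n"]
          by (simp add: a_def ennreal_of_nat_eq_real_of_nat)
      qed
    qed
    show "\<forall>\<^sub>F n in sequentially. 0 \<le> p n / a n"
      using a_pos by eventually_elim (simp add: p_def)
  qed (use eta_pos in simp)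
  have nac: "(\<lambda>n. real n / c n * a n) \<longlonglongrightarrow> \<nu> * \<eta>"
  proof (rule Lim_transform_eventually)
    show "(\<lambda>n. real n * p n / c n / (p n / a n)) \<longlonglongrightarrow> \<nu> * \<eta>"
      using tendsto_divide[OF npc pa] eta_pos by simp
    show "\<forall>\<^sub>F n in sequentially. real n * p n / c n / (p n / a n) = real n / c n * a n"
      using p_pos a_pos by eventually_elim simp
  qed

  define SN where "SN n = enn2real (SUP j\<in>{1..r n}.
          Z_expect_on M X (v n) j {\<omega> \<in> space M. N_hat M X (v n) (min (r n) (n - 3)) \<omega> > 1})" for n
  define B where "B n = a n * SN n" for n
  have SN: "SN \<longlonglongrightarrow> 0" unfolding SN_def
    using tendsto_enn2real[of _ 0] multiple by simp
  have nB: "(\<lambda>n. real n / c n * B n) \<longlonglongrightarrow> 0"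
    using tendsto_mult[OF nac SN] by (simp add: B_def mult.assoc)
  have r_le: "\<forall>\<^sub>F n in sequentially. r n = n div k n \<and> r n \<le> n - 3"
    using eventually_ge_at_top[of 6] k_gt[of 1]
  proof eventually_elim
    case (elim n)
    have "n div k n \<le> n div 2" using elim by (intro div_le_mono2) auto
    then show ?case using elim r_eq[of n] by auto
  qed
  have several: "\<forall>\<^sub>F n in sequentially. \<forall>i\<in>{1..r n}.
        expectation (\<lambda>\<omega>. mark X (v n) real i \<omega> * of_bool (1 < run_count X (v n) (r n) \<omega>)) \<le> B n"
    using int a_pos r_le order_tendstoD(2)[OF multiple, of 1, OF zero_less_one]
  proof eventually_elim
    case (elim n)
    note n = elim(1-3) and fin = elim(4)
    show ?case
    proof
      fix i assume i: "i \<in> {1..r n}"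
      let ?e = "expectation (\<lambda>\<omega>. mark X (v n) real i \<omega> * of_bool (1 < run_count X (v n) (r n) \<omega>))"
      have "N_hat M X (v n) (min (r n) (n - 3)) \<omega> = run_count X (v n) (r n) \<omega>" if "\<omega> \<in> space M" for \<omega>
        using n(3) that by (simp add: N_hat_def run_count_def min_absorb1 run_start_iff indicator_def of_bool_def)
      then have ev: "{\<omega> \<in> space M. 1 < N_hat M X (v n) (min (r n) (n - 3)) \<omega>}
        = {\<omega> \<in> space M. 1 < run_count X (v n) (r n) \<omega>}" by auto
      have "ennreal (?e / a n) = Z_expect_on M X (v n) i {\<omega> \<in> space M. 1 < run_count X (v n) (r n) \<omega>}"
        unfolding a_def using i n(1,2)
        by (intro Z_expect_on_eq[symmetric] several_runs_measurable) (auto simp: a_def)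
      also have "\<dots> \<le> (SUP j\<in>{1..r n}. Z_expect_on M X (v n) j {\<omega> \<in> space M. 1 < N_hat M X (v n) (min (r n) (n - 3)) \<omega>})"
        unfolding ev by (rule SUP_upper[OF i])
      also have "\<dots> = ennreal (SN n)"
        unfolding SN_def using fin by (intro ennreal_enn2real[symmetric]) (auto intro: less_trans)
      finally have "?e / a n \<le> SN n" by (simp add: SN_def)
      then show "?e \<le> B n" using n(2) by (simp add: B_def field_simps)
    qed
  qed

  define C where "C n = nat \<lfloor>c n\<rfloor>" for n
  have C: "y \<le> C n \<longleftrightarrow> real y \<le> c n" if "0 < c n" for y n
    using that by (simp add: C_def le_nat_iff le_floor_iff)
  define T where "T n = expectation (mark X (v n) (\<lambda>z. real z * of_bool (c n < real z)) 1)" for n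
  define Q where "Q n = expectation (mark X (v n) (\<lambda>z. (real z)\<^sup>2 * of_bool (real z \<le> c n)) 1)" for n
  have T_int: "integrable M (mark X (v n) (\<lambda>z. real z * of_bool (c n < real z)) 1)"
    if "integrable M (mark X (v n) real 1)" for n
    by (rule mark_integrable_of_le[OF that, of _ 1]) auto
  have Q_int: "integrable M (mark X (v n) (\<lambda>z. (real z)\<^sup>2 * of_bool (real z \<le> c n)) 1)"
    if "integrable M (mark X (v n) real 1)" "0 < c n" for n
  proof (rule mark_integrable_of_le[OF that(1), of _ "c n"])
    fix y
    have "(real y)\<^sup>2 * of_bool (real y \<le> c n) \<le> c n * real y"
      using that(2) by (auto simp: power2_eq_square mult_right_mono)
    also have "\<dots> \<le> c n * max 1 (real y)" using that(2) by (intro mult_left_mono) auto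
    finally show "\<bar>(real y)\<^sup>2 * of_bool (real y \<le> c n)\<bar> \<le> c n * max 1 (real y)" by simp
  qed simp
  have nT: "(\<lambda>n. real n / c n * T n) \<longlonglongrightarrow> 0"
  proof (rule Lim_transform_eventually)
    have "(\<lambda>n. T n / a n) \<longlonglongrightarrow> 0"
    proof (rule tendsto_ennrealD)
      show "(\<lambda>n. ennreal (T n / a n)) \<longlonglongrightarrow> ennreal 0"
      proof (rule Lim_transform_eventually)
        show "(\<lambda>n. \<integral>\<^sup>+z. of_nat z * indicator {z. real z > c n} z \<partial>Z_dist M X (v n) 1) \<longlonglongrightarrow> ennreal 0"
          using tail by simp
        show "\<forall>\<^sub>F n in sequentially. (\<integral>\<^sup>+z. of_nat z * indicator {z. real z > c n} z \<partial>Z_dist M X (v n) 1) = ennreal (T n / a n)"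
          using int a_pos
        proof eventually_elim
          case (elim n)
          have e: "of_nat z * indicator {z. real z > c n} z = ennreal (real z * of_bool (c n < real z))" for z
            by (simp add: ennreal_of_nat_eq_real_of_nat)
          show ?case unfolding e T_def a_def
            by (rule nn_integral_Z_dist[OF _ T_int]) (use elim in \<open>auto simp: a_def\<close>)
        qed
      qed
      show "\<forall>\<^sub>F n in sequentially. 0 \<le> T n / a n"
        using a_pos by eventually_elim (auto simp: T_def mark_def intro!: divide_nonneg_nonneg integral_nonneg_AE)
    qed simp
    from tendsto_mult[OF nac this] show "(\<lambda>n. real n / c n * a n * (T n / a n)) \<longlonglongrightarrow> 0" by simp
    show "\<forall>\<^sub>F n in sequentially. real n / c n * a n * (T n / a n) = real n / c n * T n"
      using a_pos by eventually_elim simp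
  qed
  have nQ: "(\<lambda>n. real n / (c n)\<^sup>2 * Q n) \<longlonglongrightarrow> 0"
  proof (rule Lim_transform_eventually)
    have "(\<lambda>n. 1 / c n * (Q n / a n)) \<longlonglongrightarrow> 0"
    proof (rule tendsto_ennrealD)
      show "(\<lambda>n. ennreal (1 / c n * (Q n / a n))) \<longlonglongrightarrow> ennreal 0"
      proof (rule Lim_transform_eventually)
        show "(\<lambda>n. ennreal (1 / c n) *
          (\<integral>\<^sup>+z. (of_nat z)\<^sup>2 * indicator {z. real z \<le> c n} z \<partial>Z_dist M X (v n) 1)) \<longlonglongrightarrow> ennreal 0"
          using trunc by simp
        show "\<forall>\<^sub>F n in sequentially. ennreal (1 / c n) *
          (\<integral>\<^sup>+z. (of_nat z)\<^sup>2 * indicator {z. real z \<le> c n} z \<partial>Z_dist M X (v n) 1) = ennreal (1 / c n * (Q n / a n))"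
          using int a_pos c_gt[of 0]
        proof eventually_elim
          case (elim n)
          have e: "(of_nat z)\<^sup>2 * indicator {z. real z \<le> c n} z = ennreal ((real z)\<^sup>2 * of_bool (real z \<le> c n))" for z
            by (simp add: ennreal_of_nat_eq_real_of_nat ennreal_power)
          have "(\<integral>\<^sup>+z. (of_nat z)\<^sup>2 * indicator {z. real z \<le> c n} z \<partial>Z_dist M X (v n) 1) = ennreal (Q n / a n)"
            unfolding e Q_def a_def
            by (rule nn_integral_Z_dist[OF _ Q_int]) (use elim in \<open>auto simp: a_def\<close>)
          moreover have "0 \<le> 1 / c n" using elim by simp
          ultimately show ?case by (simp only: ennreal_mult')
        qed
      qed
      show "\<forall>\<^sub>F n in sequentially. 0 \<le> 1 / c n * (Q n / a n)"
        using a_pos c_gt[of 0] by eventually_elim (auto simp: Q_def mark_def intro!: divide_nonneg_nonneg integral_nonneg_AE mult_nonneg_nonneg)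
    qed simp
    from tendsto_mult[OF nac this] show "(\<lambda>n. real n / c n * a n * (1 / c n * (Q n / a n))) \<longlonglongrightarrow> 0" by simp
    show "\<forall>\<^sub>F n in sequentially. real n / c n * a n * (1 / c n * (Q n / a n)) = real n / (c n)\<^sup>2 * Q n"
      using a_pos by eventually_elim (simp add: power2_eq_square)
  qed

  have window: "\<forall>\<^sub>F n in sequentially. real (r n) * (a n - B n) \<le> (real (r n + 2) / real (h n) + 1) * P n"
    using run_lim several
  proof eventually_elim
    case (elim n)
    then show ?case unfolding a_def P_def by (intro up_block_lower_bound h_pos) auto
  qed
  have nx: "(\<lambda>n. real n / c n * (a n - B n)) \<longlonglongrightarrow> \<nu> * \<eta>"
    using tendsto_diff[OF nac nB] by (simp add: right_diff_distrib)
  have r_div: "\<forall>\<^sub>F n in sequentially. r n = n div k n" using r_le by eventually_elim simp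
  note blocks = block_structure[OF c_lim k_lim r_div kc h_pos kP nx _ window]
  have kr: "(\<lambda>n. real (k n) * real (r n) / real n) \<longlonglongrightarrow> 1"
    and kh: "(\<lambda>n. real (k n) * real (h n) / real n) \<longlonglongrightarrow> 0"
    using blocks nu_pos eta_pos by auto

  \<comment> \<open>The end of each block that is cut off: a run of length at most \<open>C n\<close> that starts in the block reads
    \<open>2 * C n + 3\<close> further variables, and the next block must then lie at distance \<open>l n - 2\<close>.\<close>
  define g where "g n = h n + 2 * C n + 5" for n
  define m where "m n = r n - g n" for n
  have kg: "(\<lambda>n. real (k n) * real (g n) / real n) \<longlonglongrightarrow> 0"
  proof (rule Lim_null_comparison)
    show "(\<lambda>n. 6 * (real (k n) * real (h n) / real n) + 2 * (real (k n) * c n / real n)) \<longlonglongrightarrow> 0"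
      using tendsto_add[OF tendsto_mult[OF tendsto_const kh] tendsto_mult[OF tendsto_const kc], of 6 2] by simp
    show "\<forall>\<^sub>F n in sequentially. norm (real (k n) * real (g n) / real n)
      \<le> 6 * (real (k n) * real (h n) / real n) + 2 * (real (k n) * c n / real n)"
      using c_gt[of 0]
    proof eventually_elim
      case (elim n)
      have "real (g n) \<le> 6 * real (h n) + 2 * c n"
        using C[OF elim, of "C n"] h_pos[of n] by (simp add: g_def)
      then have "real (k n) * real (g n) / real n \<le> real (k n) * (6 * real (h n) + 2 * c n) / real n"
        by (intro divide_right_mono mult_left_mono) auto
      then show ?case by (simp add: distrib_left add_divide_distrib mult.left_commute)
    qed
  qed
  have half: "(0::real) < 1 / 2" "1 / 2 < (1::real)" by simp_all
  have g_le: "\<forall>\<^sub>F n in sequentially. g n \<le> r n \<and> l n \<le> int (h n)"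
    using order_tendstoD(2)[OF kg half(1)] order_tendstoD(1)[OF kr half(2)]
      k_gt[of 0] eventually_ge_at_top[of 2]
  proof eventually_elim
    case (elim n)
    have "real (k n) * real (g n) / real n < real (k n) * real (r n) / real n" using elim by linarith
    then have 1: "g n < r n" using elim by (simp add: divide_less_cancel)
    have "real (h n) \<le> real (k n) * real (g n)"
    proof -
      have "1 * real (h n) \<le> real (k n) * real (g n)" using elim by (intro mult_mono) (auto simp: g_def)
      then show ?thesis by simp
    qed
    also have "\<dots> < real n / 2" using elim by (simp add: field_simps)
    finally have "2 * h n < n" by simp
    then have "l n \<le> int (h n)" by (auto simp: h_def)
    with 1 show ?case by simp
  qed
  have full: "(\<lambda>n. real (k n) * real (m n) / real n) \<longlonglongrightarrow> 1"
  proof (rule Lim_transform_eventually)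
    show "(\<lambda>n. real (k n) * real (r n) / real n - real (k n) * real (g n) / real n) \<longlonglongrightarrow> 1"
      using tendsto_diff[OF kr kg] by simp
    show "\<forall>\<^sub>F n in sequentially. real (k n) * real (r n) / real n - real (k n) * real (g n) / real n
      = real (k n) * real (m n) / real n"
      using g_le by eventually_elim (simp add: m_def of_nat_diff right_diff_distrib diff_divide_distrib)
  qed
  have sep: "\<forall>\<^sub>F n in sequentially. m n + 2 * C n + 3 \<le> r n \<and>
        int (m n + 2 * C n + 2) + (l n - 2) \<le> int (r n) \<and> k n * r n \<le> n"
    using g_le r_div
  proof eventually_elim
    case (elim n)
    then have "m n + h n + 2 * C n + 5 \<le> r n" by (simp add: m_def g_def)
    then show ?case using elim by auto
  qed
  note law = mark_sum_weak_law[OF int c_gt[of 0] k_lim sep full mix _ _ _ _ several nB]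

  have law_bar: "tendsto_in_prob M (\<lambda>n \<omega>. (\<Sum>i=1..n - 3. mark X (v n) real i \<omega>) / c n) \<nu>"
  proof (rule law)
    show "(\<lambda>n. real n / c n * expectation (mark X (v n) real 1)) \<longlonglongrightarrow> \<nu>"
      by (rule Lim_transform_eventually[OF npc]) (use mean_real in \<open>eventually_elim, simp\<close>)
    show "(\<lambda>n. real n / c n * expectation (mark X (v n) (\<lambda>y. real y - truncated real (C n) y) 1)) \<longlonglongrightarrow> 0"
    proof (rule Lim_transform_eventually[OF nT])
      show "\<forall>\<^sub>F n in sequentially. real n / c n * T n
        = real n / c n * expectation (mark X (v n) (\<lambda>y. real y - truncated real (C n) y) 1)"
        using c_gt[of 0]
      proof eventually_elim
        case (elim n)
        have "(\<lambda>y. real y - truncated real (C n) y) = (\<lambda>z. real z * of_bool (c n < real z))"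
          using C[OF elim] by (auto simp: truncated_def fun_eq_iff)
        then show ?case by (simp add: T_def)
      qed
    qed
    show "(\<lambda>n. real n / (c n)\<^sup>2 * expectation (mark X (v n) (\<lambda>y. (truncated real (C n) y)\<^sup>2) 1)) \<longlonglongrightarrow> 0"
    proof (rule Lim_transform_eventually[OF nQ])
      show "\<forall>\<^sub>F n in sequentially. real n / (c n)\<^sup>2 * Q n
        = real n / (c n)\<^sup>2 * expectation (mark X (v n) (\<lambda>y. (truncated real (C n) y)\<^sup>2) 1)"
        using c_gt[of 0]
      proof eventually_elim
        case (elim n)
        have "(\<lambda>y. (truncated real (C n) y)\<^sup>2) = (\<lambda>z. (real z)\<^sup>2 * of_bool (real z \<le> c n))"
          using C[OF elim] by (auto simp: truncated_def fun_eq_iff)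
        then show ?case by (simp add: Q_def)
      qed
    qed
  qed auto
  have law_hat: "tendsto_in_prob M (\<lambda>n \<omega>. (\<Sum>i=1..n - 3. mark X (v n) (\<lambda>_. 1) i \<omega>) / c n) (\<nu> * \<eta>)"
  proof (rule law)
    show "(\<lambda>n. real n / c n * expectation (mark X (v n) (\<lambda>_. 1) 1)) \<longlonglongrightarrow> \<nu> * \<eta>"
      using nac by (simp add: a_def)
    \<comment> \<open>A run longer than \<open>c n\<close> is dominated by its length, and runs without end form a null event.\<close>
    show "(\<lambda>n. real n / c n * expectation (mark X (v n) (\<lambda>y. 1 - truncated (\<lambda>_. 1) (C n) y) 1)) \<longlonglongrightarrow> 0"
    proof (rule Lim_null_comparison[OF _ nT])
      show "\<forall>\<^sub>F n in sequentially. norm (real n / c n * expectation (mark X (v n) (\<lambda>y. 1 - truncated (\<lambda>_. 1) (C n) y) 1))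
        \<le> real n / c n * T n"
        using c_gt[of 0] int run_lim
      proof eventually_elim
        case (elim n)
        have i: "integrable M (mark X (v n) (\<lambda>y. 1 - truncated (\<lambda>_. 1) (C n) y) 1)"
          by (rule mark_integrable_of_le[OF elim(2), of _ 1]) (auto simp: truncated_def)
        have "expectation (mark X (v n) (\<lambda>y. 1 - truncated (\<lambda>_. 1) (C n) y) 1) \<le> T n"
          unfolding T_def
        proof (rule expectation_mark_mono[OF elim(3) _ i T_int[OF elim(2)]])
          show "1 - truncated (\<lambda>_. 1) (C n) y \<le> real y * of_bool (c n < real y)" if "1 \<le> y" for y
            using that C[OF elim(1), of y] by (cases "y \<le> C n") (simp_all add: truncated_def)
        qed
        moreover have "0 \<le> expectation (mark X (v n) (\<lambda>y. 1 - truncated (\<lambda>_. 1) (C n) y) 1)"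
          by (intro integral_nonneg_AE) (auto simp: mark_def truncated_def)
        ultimately show ?case using elim(1) by (simp add: abs_mult mult_left_mono divide_right_mono)
      qed
    qed
    show "(\<lambda>n. real n / (c n)\<^sup>2 * expectation (mark X (v n) (\<lambda>y. (truncated (\<lambda>_. 1) (C n) y)\<^sup>2) 1)) \<longlonglongrightarrow> 0"
    proof (rule Lim_null_comparison[OF _ nQ])
      show "\<forall>\<^sub>F n in sequentially. norm (real n / (c n)\<^sup>2 * expectation (mark X (v n) (\<lambda>y. (truncated (\<lambda>_. 1) (C n) y)\<^sup>2) 1))
        \<le> real n / (c n)\<^sup>2 * Q n"
        using c_gt[of 0] int run_lim
      proof eventually_elim
        case (elim n)
        have i: "integrable M (mark X (v n) (\<lambda>y. (truncated (\<lambda>_. 1) (C n) y)\<^sup>2) 1)"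
          by (rule mark_integrable_of_le[OF elim(2), of _ 1]) (auto simp: truncated_def)
        have "expectation (mark X (v n) (\<lambda>y. (truncated (\<lambda>_. 1) (C n) y)\<^sup>2) 1) \<le> Q n"
          unfolding Q_def
        proof (rule expectation_mark_mono[OF elim(3) _ i Q_int[OF elim(2,1)]])
          show "(truncated (\<lambda>_. 1) (C n) y)\<^sup>2 \<le> (real y)\<^sup>2 * of_bool (real y \<le> c n)" if "1 \<le> y" for y
            using that C[OF elim(1), of y] by (cases "y \<le> C n") (simp_all add: truncated_def)
        qed
        moreover have "0 \<le> expectation (mark X (v n) (\<lambda>y. (truncated (\<lambda>_. 1) (C n) y)\<^sup>2) 1)"
          by (intro integral_nonneg_AE) (auto simp: mark_def)
        ultimately show ?case by (simp add: abs_mult mult_left_mono divide_right_mono)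
      qed
    qed
  qed auto
  have meas: "(\<lambda>\<omega>. (\<Sum>i=1..n - 3. mark X (v n) f i \<omega>) / c n) \<in> borel_measurable M" for n f
    by (intro borel_measurable_divide borel_measurable_sum borel_measurable_const mark_measurable) auto
  have "tendsto_in_prob M (\<lambda>n \<omega>. ((\<Sum>i=1..n - 3. mark X (v n) (\<lambda>_. 1) i \<omega>) / c n)
      / ((\<Sum>i=1..n - 3. mark X (v n) real i \<omega>) / c n)) (\<nu> * \<eta> / \<nu>)"
    by (rule tendsto_in_prob_divide[OF meas meas law_hat law_bar]) (use nu_pos in simp)
  moreover have "\<nu> * \<eta> / \<nu> = \<eta>" using nu_pos by simp
  ultimately have "tendsto_in_prob M (\<lambda>n \<omega>. ((\<Sum>i=1..n - 3. mark X (v n) (\<lambda>_. 1) i \<omega>) / c n)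
      / ((\<Sum>i=1..n - 3. mark X (v n) real i \<omega>) / c n)) \<eta>" by (simp only:)
  then show ?thesis
  proof (rule tendsto_in_prob_cong)
    show "\<forall>\<^sub>F n in sequentially. \<forall>\<omega>\<in>space M. ((\<Sum>i=1..n - 3. mark X (v n) (\<lambda>_. 1) i \<omega>) / c n)
      / ((\<Sum>i=1..n - 3. mark X (v n) real i \<omega>) / c n) = eta_hat M X (v n) n \<omega>"
      using c_gt[of 0]
    proof eventually_elim
      case (elim n)
      show ?case
      proof
        fix \<omega> assume "\<omega> \<in> space M"
        then have start: "indicator (run_start M X (v n) i) \<omega> = (of_bool (starts_run X (v n) i \<omega>) :: nat)" for i
          by (simp add: run_start_iff indicator_def)
        have "real (N_hat M X (v n) (n - 3) \<omega>) = (\<Sum>i=1..n - 3. mark X (v n) (\<lambda>_. 1) i \<omega>)"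
          "real (N_bar M X (v n) (n - 3) \<omega>) = (\<Sum>i=1..n - 3. mark X (v n) real i \<omega>)"
          unfolding N_hat_def N_bar_def of_nat_sum start by (simp_all add: mark_def)
        then show "((\<Sum>i=1..n - 3. mark X (v n) (\<lambda>_. 1) i \<omega>) / c n)
          / ((\<Sum>i=1..n - 3. mark X (v n) real i \<omega>) / c n) = eta_hat M X (v n) n \<omega>"
          using elim by (simp add: eta_hat_def)
      qed
    qed
  qed
qed

end
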